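(* Let $\sigma^2\in\mathbb{R}_+$ and let $\alpha$ be a random variable with values in $[0,1)$ having a probability density function of the form $\psi(x)(1-x)^{\beta}$, $x\in[0,1)$, where $\psi$ is an integrable function on $[0,1)$ having a limit $\lim_{x\uparrow 1}\psi(x)=\psi_1\in(0,\infty)$. Let $(\alpha^{(j)},(X^{(j)}_k)_{k\in\mathbb{Z}_+})$, $j\in\mathbb{N}$, be independent copies of $(\alpha,(X_k)_{k\in\mathbb{Z}_+})$, where $(X_k)_{k\in\mathbb{Z}_+}$ is the randomized AR(1) process with random coefficient $\alpha$ and Gaussian innovations with mean zero and variance $\sigma^2$, and for $N,n\in\mathbb{N}$ put $$\widetilde S^{(N,n)}_t:=\sum_{j=1}^N\sum_{k=1}^{\lfloor nt\rfloor}X^{(j)}_k,\qquad t\in\mathbb{R}_+ .$$ If $\beta=1$, then $$\mathcal{D}_{\mathrm f}\text{-}\lim_{n\to\infty}\ \mathcal{D}_{\mathrm f}\text{-}\lim_{N\to\infty}\ (n\log n)^{-\frac12}N^{-\frac12}\,\widetilde S^{(N,n)}=\sqrt{\sigma^2\psi_1}\,B,$$ where $B=(B_t)_{t\in\mathbb{R}_+}$ is a standard Wiener process.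
   Context: $\mathbb{Z}_+$, $\mathbb{N}$, $\mathbb{R}_+$ denote the non-negative integers, the positive integers and the non-negative real numbers. Randomized AR(1) process with Gaussian innovations: $$X_k=\alpha X_{k-1}+\varepsilon_k,\qquad k\in\mathbb{N},$$ where $(\varepsilon_k)_{k\in\mathbb{N}}$ are i.i.d. Gaussian random variables with mean $0$ and variance $\sigma^2$, independent of $\alpha$, and, conditionally on $\alpha$, $(X_k)_{k\in\mathbb{Z}_+}$ is a strictly stationary AR(1) process with coefficient $\alpha$ (so that, conditionally on $\alpha$, $X_0$ is independent of $(\varepsilon_k)_{k\in\mathbb{N}}$ and has the unique stationary distribution, namely the normal distribution with mean $0$ and variance $\sigma^2/(1-\alpha^2)$). The innovations are idiosyncratic: the innovation sequences belonging to different copies $j$ are independent. $\mathcal{D}_{\mathrm f}\text{-}\lim$ denotes weak convergence of the finite-dimensional distributions of stochastic processes indexed by $t\in\mathbb{R}_+$. In the iterated limit, one first takes $N\to\infty$ for fixed $n$ (inner limit), and then lets $n\to\infty$ in the resulting limit process (outer limit). *)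

theory Defs
  imports "HOL-Probability.Probability"
begin

text \<open>
  The normal law with mean \<open>m\<close> and variance \<open>v\<close>. The variance may be \<open>0\<close>, where
  \<^const>\<open>normal_density\<close> would give the null measure instead of the point mass at \<open>m\<close>.
\<close>

definition normal_law :: "real \<Rightarrow> real \<Rightarrow> real measure" where
  "normal_law m v =
     (if v = 0 then return borel m else density lborel (\<lambda>x. ennreal (normal_density m (sqrt v) x)))"

definition real_process :: "'a measure \<Rightarrow> (real \<Rightarrow> 'a \<Rightarrow> real) \<Rightarrow> bool" where
  "real_process M Z \<longleftrightarrow> prob_space M \<and> (\<forall>t\<ge>0. Z t \<in> borel_measurable M)"

definition fin_dim_distr :: "'a measure \<Rightarrow> (real \<Rightarrow> 'a \<Rightarrow> real) \<Rightarrow> real set \<Rightarrow> (real \<Rightarrow> real) measure" where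
  "fin_dim_distr M Z I = distr M (\<Pi>\<^sub>M t\<in>I. borel) (\<lambda>\<omega>. \<lambda>t\<in>I. Z t \<omega>)"

text \<open>
  Weak convergence of probability laws on \<open>\<real>\<^sup>I\<close>, for a finite index set \<open>I\<close>: convergence of the
  integrals of all bounded continuous functions.
\<close>

definition weak_conv_Pi ::
    "real set \<Rightarrow> (nat \<Rightarrow> (real \<Rightarrow> real) measure) \<Rightarrow> (real \<Rightarrow> real) measure \<Rightarrow> bool" where
  "weak_conv_Pi I \<mu> \<nu> \<longleftrightarrow>
     (\<forall>f. continuous_map (powertop_real I) euclideanreal f \<and> bounded (f ` (I \<rightarrow>\<^sub>E UNIV)) \<longrightarrow>
        (\<lambda>n. \<integral>x. f x \<partial>\<mu> n) \<longlonglongrightarrow> (\<integral>x. f x \<partial>\<nu>))"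

text \<open>
  Weak convergence of the finite-dimensional distributions. The processes \<open>Z n\<close> may live on
  different probability spaces \<open>M n\<close>, and the limit \<open>Y\<close> on yet another one.
\<close>

definition fdd_lim ::
    "(nat \<Rightarrow> 'a measure) \<Rightarrow> (nat \<Rightarrow> real \<Rightarrow> 'a \<Rightarrow> real) \<Rightarrow> 'b measure \<Rightarrow> (real \<Rightarrow> 'b \<Rightarrow> real) \<Rightarrow> bool" where
  "fdd_lim M Z L Y \<longleftrightarrow>
     (\<forall>I. finite I \<and> I \<subseteq> {0..} \<longrightarrow>
        weak_conv_Pi I (\<lambda>n. fin_dim_distr (M n) (Z n) I) (fin_dim_distr L Y I))"

definition standard_wiener :: "'a measure \<Rightarrow> (real \<Rightarrow> 'a \<Rightarrow> real) \<Rightarrow> bool" where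
  "standard_wiener L B \<longleftrightarrow>
     real_process L B \<and>
     (AE \<omega> in L. B 0 \<omega> = 0) \<and>
     (\<forall>s t. 0 \<le> s \<and> s \<le> t \<longrightarrow> distr L borel (\<lambda>\<omega>. B t \<omega> - B s \<omega>) = normal_law 0 (t - s)) \<and>
     (\<forall>(n::nat) u. 0 \<le> u 0 \<and> mono u \<longrightarrow>
        prob_space.indep_vars L (\<lambda>_. borel) (\<lambda>i \<omega>. B (u (Suc i)) \<omega> - B (u i) \<omega>) {..<n}) \<and>
     (AE \<omega> in L. continuous_on {0..} (\<lambda>t. B t \<omega>))"

text \<open>Innovation sequences are indexed by the positive integers.\<close>

abbreviation seq0_space :: "(nat \<Rightarrow> real) measure" where
  "seq0_space \<equiv> \<Pi>\<^sub>M k\<in>UNIV. borel"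

abbreviation seq1_space :: "(nat \<Rightarrow> real) measure" where
  "seq1_space \<equiv> \<Pi>\<^sub>M k\<in>{1..}. borel"

definition strictly_stationary :: "'a measure \<Rightarrow> (nat \<Rightarrow> 'a \<Rightarrow> real) \<Rightarrow> bool" where
  "strictly_stationary M X \<longleftrightarrow>
     (\<forall>k. X k \<in> borel_measurable M) \<and>
     (\<forall>h. distr M seq0_space (\<lambda>\<omega> k. X (k + h) \<omega>) = distr M seq0_space (\<lambda>\<omega> k. X k \<omega>))"

definition gaussian_innovations :: "'a measure \<Rightarrow> real \<Rightarrow> (nat \<Rightarrow> 'a \<Rightarrow> real) \<Rightarrow> bool" where
  "gaussian_innovations M v \<epsilon> \<longleftrightarrow>
     prob_space.indep_vars M (\<lambda>_. borel) \<epsilon> {1..} \<and>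
     (\<forall>k\<ge>1. distr M borel (\<epsilon> k) = normal_law 0 v)"

text \<open>
  Independence of two random variables with values in spaces of different types; the library's
  \<open>indep_var\<close> requires a common value type.
\<close>

definition indep_pair ::
    "'a measure \<Rightarrow> 'b measure \<Rightarrow> ('a \<Rightarrow> 'b) \<Rightarrow> 'c measure \<Rightarrow> ('a \<Rightarrow> 'c) \<Rightarrow> bool" where
  "indep_pair M S U T V \<longleftrightarrow>
     U \<in> M \<rightarrow>\<^sub>M S \<and> V \<in> M \<rightarrow>\<^sub>M T \<and>
     prob_space.indep_set M {U -` A \<inter> space M | A. A \<in> sets S} {V -` A \<inter> space M | A. A \<in> sets T}"

text \<open>
  The stationary AR(1) process with a deterministic coefficient \<open>a\<close>. For \<open>\<bar>a\<bar> < 1\<close> these conditions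
  force \<open>X 0\<close> to have the law \<open>normal_law 0 (v / (1 - a\<^sup>2))\<close>.
\<close>

definition stationary_ar1 ::
    "'a measure \<Rightarrow> real \<Rightarrow> real \<Rightarrow> (nat \<Rightarrow> 'a \<Rightarrow> real) \<Rightarrow> (nat \<Rightarrow> 'a \<Rightarrow> real) \<Rightarrow> bool" where
  "stationary_ar1 M a v X \<epsilon> \<longleftrightarrow>
     prob_space M \<and>
     gaussian_innovations M v \<epsilon> \<and>
     indep_pair M borel (X 0) seq1_space (\<lambda>\<omega>. \<lambda>k\<in>{1..}. \<epsilon> k \<omega>) \<and>
     (\<forall>k\<ge>1. AE \<omega> in M. X k \<omega> = a * X (k - 1) \<omega> + \<epsilon> k \<omega>) \<and>
     strictly_stationary M X"

text \<open>\<open>\<kappa>\<close> is a regular conditional distribution of \<open>Y\<close> (with values in \<open>S\<close>) given \<open>\<alpha>\<close>.\<close>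

definition cond_law_given ::
    "'a measure \<Rightarrow> ('a \<Rightarrow> real) \<Rightarrow> 'b measure \<Rightarrow> ('a \<Rightarrow> 'b) \<Rightarrow> (real \<Rightarrow> 'b measure) \<Rightarrow> bool" where
  "cond_law_given M \<alpha> S Y \<kappa> \<longleftrightarrow>
     \<alpha> \<in> borel_measurable M \<and> Y \<in> M \<rightarrow>\<^sub>M S \<and> \<kappa> \<in> borel \<rightarrow>\<^sub>M prob_algebra S \<and>
     (\<forall>A\<in>sets borel. \<forall>C\<in>sets S.
        emeasure M {\<omega>\<in>space M. \<alpha> \<omega> \<in> A \<and> Y \<omega> \<in> C}
          = (\<integral>\<^sup>+a\<in>A. emeasure (\<kappa> a) C \<partial>distr M borel \<alpha>))"

text \<open>
  Conditioning on \<open>\<alpha>\<close> is expressed through the conditional law \<open>\<kappa>\<close> of the pair of sequences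
  \<open>(X, \<epsilon>)\<close>: for almost every value \<open>a\<close> of \<open>\<alpha>\<close>, the two coordinate sequences on the space of pairs
  form, under \<open>\<kappa> a\<close>, a stationary AR(1) process with coefficient \<open>a\<close>.
\<close>

definition randomized_ar1 ::
    "'a measure \<Rightarrow> real \<Rightarrow> ('a \<Rightarrow> real) \<Rightarrow> (nat \<Rightarrow> 'a \<Rightarrow> real) \<Rightarrow> bool" where
  "randomized_ar1 M v \<alpha> X \<longleftrightarrow>
     prob_space M \<and>
     (\<exists>\<epsilon> \<kappa>.
        gaussian_innovations M v \<epsilon> \<and>
        indep_pair M borel \<alpha> seq1_space (\<lambda>\<omega>. \<lambda>k\<in>{1..}. \<epsilon> k \<omega>) \<and>
        (\<forall>k\<ge>1. AE \<omega> in M. X k \<omega> = \<alpha> \<omega> * X (k - 1) \<omega> + \<epsilon> k \<omega>) \<and>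
        cond_law_given M \<alpha> (seq0_space \<Otimes>\<^sub>M seq1_space)
          (\<lambda>\<omega>. (\<lambda>k. X k \<omega>, \<lambda>k\<in>{1..}. \<epsilon> k \<omega>)) \<kappa> \<and>
        (AE a in distr M borel \<alpha>.
           stationary_ar1 (\<kappa> a) a v (\<lambda>k w. fst w k) (\<lambda>k w. snd w k)))"

text \<open>
  The pairs \<open>(\<alpha>j j, Xj j)\<close>, \<open>j \<ge> 1\<close>, on \<open>M\<close> are independent copies of \<open>(\<alpha>, X)\<close> on \<open>M0\<close>. The
  innovations are measurable functions of \<open>(\<alpha>, X)\<close> up to null sets, so those belonging to
  different copies are independent as well.
\<close>

definition independent_copies ::
    "'a measure \<Rightarrow> (nat \<Rightarrow> 'a \<Rightarrow> real) \<Rightarrow> (nat \<Rightarrow> nat \<Rightarrow> 'a \<Rightarrow> real) \<Rightarrow>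
     'b measure \<Rightarrow> ('b \<Rightarrow> real) \<Rightarrow> (nat \<Rightarrow> 'b \<Rightarrow> real) \<Rightarrow> bool" where
  "independent_copies M \<alpha>j Xj M0 \<alpha> X \<longleftrightarrow>
     prob_space M \<and>
     prob_space.indep_vars M (\<lambda>_. borel \<Otimes>\<^sub>M seq0_space) (\<lambda>j \<omega>. (\<alpha>j j \<omega>, \<lambda>k. Xj j k \<omega>)) {1..} \<and>
     (\<forall>j\<ge>1. distr M (borel \<Otimes>\<^sub>M seq0_space) (\<lambda>\<omega>. (\<alpha>j j \<omega>, \<lambda>k. Xj j k \<omega>))
            = distr M0 (borel \<Otimes>\<^sub>M seq0_space) (\<lambda>\<omega>. (\<alpha> \<omega>, \<lambda>k. X k \<omega>)))"

definition aggregated_sum ::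
    "(nat \<Rightarrow> nat \<Rightarrow> 'a \<Rightarrow> real) \<Rightarrow> nat \<Rightarrow> nat \<Rightarrow> real \<Rightarrow> 'a \<Rightarrow> real" where
  "aggregated_sum Xj N n t \<omega> = (\<Sum>j=1..N. \<Sum>k=1..nat \<lfloor>real n * t\<rfloor>. Xj j k \<omega>)"

text \<open>
  The iterated limit: for each \<open>n \<ge> n0\<close> the inner limit \<open>Y n\<close> as \<open>N \<rightarrow> \<infinity>\<close> exists, and the processes
  \<open>Y n\<close> converge to \<open>W\<close> as \<open>n \<rightarrow> \<infinity>\<close>. Only the laws of the \<open>Y n\<close> matter; since any real process
  indexed by \<open>{0..}\<close> can be realised on the path space \<open>real \<Rightarrow> real\<close>, letting \<open>Y n\<close> live
  on a measure over that type is no restriction.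
\<close>

definition iterated_fdd_lim ::
    "nat \<Rightarrow> 'a measure \<Rightarrow> (nat \<Rightarrow> nat \<Rightarrow> real \<Rightarrow> 'a \<Rightarrow> real) \<Rightarrow> 'b measure \<Rightarrow> (real \<Rightarrow> 'b \<Rightarrow> real) \<Rightarrow> bool" where
  "iterated_fdd_lim n0 M Z L W \<longleftrightarrow>
     (\<exists>(Q :: nat \<Rightarrow> (real \<Rightarrow> real) measure) Y.
        (\<forall>n\<ge>n0. real_process (Q n) (Y n) \<and> fdd_lim (\<lambda>_. M) (\<lambda>N. Z N n) (Q n) (Y n)) \<and>
        fdd_lim Q Y L W)"

end

theory Submission
  imports Defs
begin

text \<open>
  For fixed \<open>n\<close>, the sum over the first \<open>N\<close> copies is a sum of independent, identically distributed,
  centred and square-integrable random vectors. By the central limit theorem the limit \<open>N \<rightarrow> \<infinity>\<close> is a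
  centred Gaussian process with the covariance of a single copy. Given \<open>\<alpha> = a\<close> the stationary AR(1)
  process has the covariance \<open>\<sigma>\<^sup>2 a\<^bsup>|k-l|\<^esup> / (1 - a\<^sup>2)\<close>; the factor \<open>1 - x\<close> of the density
  \<open>\<psi>(x) (1 - x)\<close> cancels the singularity at \<open>1\<close>, so a copy has the covariance \<open>\<sigma>\<^sup>2 r(|k-l|)\<close> with
  \<open>r(h) = \<integral> \<psi>(x) / (1 + x) x\<^sup>h dx\<close> (\<open>randomized_ar1_moments\<close>). The inner limit is therefore the
  partial sum process of a Gaussian sequence with this covariance; such a sequence is written down
  explicitly as a triangular transformation of Gaussian noise (\<open>gaussian_sequence_exists\<close>).

  In the outer limit only the variance \<open>\<sigma>\<^sup>2 V(m)\<close> of a sum of \<open>m\<close> consecutive terms matters: by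
  stationarity the covariance of the sums of the first \<open>p\<close> and the first \<open>q \<ge> p\<close> terms is
  \<open>\<sigma>\<^sup>2 (V(p) + V(q) - V(q - p)) / 2\<close>. Now \<open>V(m) = \<integral> \<psi>(x) / (1 + x) T\<^sub>m(x) dx\<close> with
  \<open>T\<^sub>m(x) = \<Sum>\<^sub>k\<^sub>,\<^sub>l x\<^bsup>|k-l|\<^esup>\<close>. The kernel \<open>T\<^sub>m\<close> has the integral \<open>2 (m + 1) H\<^sub>m - 3 m \<sim> 2 m log m\<close>
  over \<open>[0, 1)\<close>, but the bound \<open>T\<^sub>m(x) \<le> 2 m / (1 - x)\<close> keeps it of order \<open>m\<close> away from \<open>1\<close>.
  Thus \<open>T\<^sub>m / (2 m log m)\<close> concentrates at \<open>1\<close>, where \<open>\<psi>(x) / (1 + x)\<close> tends to \<open>\<psi>\<^sub>1 / 2\<close>, and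
  \<open>V(m) \<sim> \<psi>\<^sub>1 m log m\<close> (\<open>toeplitz_mixed_moment_asymp\<close>). After division by \<open>n log n\<close> the covariance at
  the times \<open>s \<le> t\<close> tends to \<open>\<sigma>\<^sup>2 \<psi>\<^sub>1 (s + t - (t - s)) / 2 = \<sigma>\<^sup>2 \<psi>\<^sub>1 min s t\<close>, which is the covariance
  of \<open>sqrt (\<sigma>\<^sup>2 \<psi>\<^sub>1) B\<close>.

  Both limits are taken on the characteristic functions of linear combinations of finitely many
  coordinates, and \<open>levy_continuity_Pi\<close> turns their convergence into weak convergence on \<open>\<real>\<^sup>I\<close>.
\<close>


section \<open>Characteristic functions and weak convergence on finite products\<close>

text \<open>
  The Stone-Weierstrass theorem will be applied to boxes in \<open>real \<Rightarrow> real\<close>, for which the product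
  topology has to be Hausdorff. Each separation axiom is inherited through a coordinate in which the
  two functions differ.
\<close>

instance "fun" :: (type, t0_space) t0_space
proof
  fix x y :: "'a \<Rightarrow> 'b" assume "x \<noteq> y"
  then obtain i where "x i \<noteq> y i" by auto
  then obtain U where "open U" "(x i \<in> U) \<noteq> (y i \<in> U)"
    using Topological_Spaces.t0_space by metis
  moreover from this have "open ((\<lambda>x::'a \<Rightarrow> 'b. x i) -` U)" by (auto intro!: open_vimage)
  ultimately show "\<exists>U. open U \<and> (x \<in> U) \<noteq> (y \<in> U)"
    by (intro exI[of _ "(\<lambda>x. x i) -` U"]) auto
qed

instance "fun" :: (type, t1_space) t1_space
proof
  fix x y :: "'a \<Rightarrow> 'b" assume "x \<noteq> y"
  then obtain i where "x i \<noteq> y i" by auto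
  then obtain U where "open U" "x i \<in> U" "y i \<notin> U"
    using t1_space[of "x i" "y i"] by auto
  moreover from this have "open ((\<lambda>x::'a \<Rightarrow> 'b. x i) -` U)" by (auto intro!: open_vimage)
  ultimately show "\<exists>U. open U \<and> x \<in> U \<and> y \<notin> U"
    by (intro exI[of _ "(\<lambda>x. x i) -` U"]) auto
qed

instance "fun" :: (type, t2_space) t2_space
proof
  fix x y :: "'a \<Rightarrow> 'b" assume "x \<noteq> y"
  then obtain i where "x i \<noteq> y i" by auto
  then obtain U V where UV: "open U" "open V" "x i \<in> U" "y i \<in> V" "U \<inter> V = {}"
    using hausdorff[of "x i" "y i"] by auto
  have "open ((\<lambda>x. x i) -` U)" "open ((\<lambda>x::'a \<Rightarrow> 'b. x i) -` V)"
    using UV(1,2) by (auto intro!: open_vimage)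
  with UV show "\<exists>U V. open U \<and> open V \<and> x \<in> U \<and> y \<in> V \<and> U \<inter> V = {}"
    by (intro exI[of _ "(\<lambda>x. x i) -` U"] exI[of _ "(\<lambda>x. x i) -` V"]) auto
qed

text \<open>
  The phase \<open>b\<close> covers sines as well as cosines, which leaves a single generator. By the
  product-to-sum formula the linear span of the waves is already an algebra.
\<close>

inductive_set trig_sums :: "'i set \<Rightarrow> (('i \<Rightarrow> real) \<Rightarrow> real) set" for I where
  wave: "(\<lambda>x. c * cos ((\<Sum>i\<in>I. \<theta> i * x i) + b)) \<in> trig_sums I"
| add: "f \<in> trig_sums I \<Longrightarrow> g \<in> trig_sums I \<Longrightarrow> (\<lambda>x. f x + g x) \<in> trig_sums I"

lemma trig_sums_mult:
  assumes "f \<in> trig_sums I" "g \<in> trig_sums I"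
  shows "(\<lambda>x. f x * g x) \<in> trig_sums I"
  using assms
proof (induction arbitrary: g)
  case (wave c \<theta> b)
  from wave.prems show ?case
  proof (induction)
    case (wave c' \<theta>' b')
    have eq: "(\<lambda>x. c * cos ((\<Sum>i\<in>I. \<theta> i * x i) + b) * (c' * cos ((\<Sum>i\<in>I. \<theta>' i * x i) + b')))
      = (\<lambda>x. c * c' / 2 * cos ((\<Sum>i\<in>I. (\<theta> i - \<theta>' i) * x i) + (b - b'))
           + c * c' / 2 * cos ((\<Sum>i\<in>I. (\<theta> i + \<theta>' i) * x i) + (b + b')))"
      by (rule ext, simp only: left_diff_distrib distrib_right sum_subtractf sum.distrib)
         (simp add: cos_add cos_diff sin_add sin_diff algebra_simps)
    show ?case unfolding eq by (rule trig_sums.add; rule trig_sums.wave)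
  next
    case (add f g)
    show ?case unfolding distrib_left by (rule trig_sums.add[OF add.IH])
  qed
next
  case (add f g h)
  show ?case unfolding distrib_right by (rule trig_sums.add[OF add.IH(1)[OF add.prems] add.IH(2)[OF add.prems]])
qed

lemma trig_sums_const: "(\<lambda>x. c) \<in> trig_sums I"
  using trig_sums.wave[of c "\<lambda>_. 0" I 0] by simp

lemma trig_sums_continuous:
  assumes "f \<in> trig_sums I" shows "continuous_on S f"
  using assms
proof induction
  case (wave c \<theta> b)
  then show ?case
    by (intro continuous_intros continuous_on_subset[OF continuous_on_product_coordinates]) auto
qed (intro continuous_intros)

lemma trig_sums_measurable:
  assumes "f \<in> trig_sums I" shows "f \<in> borel_measurable (PiM I (\<lambda>_. borel))"
  using assms
proof induction
  case (wave c \<theta> b)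
  then show ?case by measurable
qed measurable

lemma trig_sums_bounded:
  assumes "f \<in> trig_sums I" shows "\<exists>C. \<forall>x. \<bar>f x\<bar> \<le> C"
  using assms
proof induction
  case (wave c \<theta> b)
  show ?case
    by (rule exI[of _ "\<bar>c\<bar>"]) (simp add: abs_mult mult_left_le)
next
  case (add f g)
  then obtain C D where "\<forall>x. \<bar>f x\<bar> \<le> C" "\<forall>x. \<bar>g x\<bar> \<le> D" by blast
  then have "\<bar>f x + g x\<bar> \<le> C + D" for x
    using abs_triangle_ineq[of "f x" "g x"] by (smt (verit))
  then show ?case by blast
qed

text \<open>
  Points of the box are separated by \<open>sin (x\<^sub>t / (R + 1))\<close>: its argument stays within \<open>[-1, 1]\<close>, where
  the sine is injective.
\<close>

lemma trig_sums_function_ring_on: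
  fixes I :: "'i set"
  assumes I: "finite I"
  shows "function_ring_on (trig_sums I) (PiE I (\<lambda>_. {- R..R}))"
proof
  show "compact (PiE I (\<lambda>_. {- R..R}))"
  proof -
    \<comment> \<open>Outside \<open>I\<close> extensional functions are constantly \<open>undefined\<close>, so the box is compact by Tychonoff.\<close>
    have eq: "PiE I (\<lambda>_. {- R..R}) = PiE UNIV (\<lambda>i. if i \<in> I then {- R..R} else {undefined})"
      by (auto simp: PiE_iff extensional_def split: if_splits)
    have "compactin (product_topology (\<lambda>i. euclidean) UNIV)
        (PiE UNIV (\<lambda>i::'i. if i \<in> I then {- R..R} else {undefined}))"
      by (subst compactin_PiE) auto
    then show ?thesis by (simp add: eq euclidean_product_topology)
  qed
next
  fix x y :: "'i \<Rightarrow> real" assume x: "x \<in> PiE I (\<lambda>_. {- R..R})" and y: "y \<in> PiE I (\<lambda>_. {- R..R})" and "x \<noteq> y"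
  then obtain t where t: "t \<in> I" "x t \<noteq> y t" by (metis PiE_ext)
  with x have R: "- R \<le> x t" "x t \<le> R" "- R \<le> y t" "y t \<le> R" using y by (auto simp: PiE_iff)
  define \<theta> where "\<theta> = (\<lambda>i. if i = t then 1 / (R + 1) else 0)"
  have s: "(\<Sum>i\<in>I. \<theta> i * z i) = z t / (R + 1)" for z
    using t I by (simp add: \<theta>_def if_distrib[of "\<lambda>a. a * _"] sum.delta cong: if_cong)
  have lim: "\<bar>z t / (R + 1)\<bar> \<le> pi / 2" if "- R \<le> z t" "z t \<le> R" for z
  proof -
    have "\<bar>z t / (R + 1)\<bar> \<le> 1" using that by (auto simp: abs_le_iff divide_simps)
    then show ?thesis using pi_gt3 by linarith
  qed
  have "sin (x t / (R+1)) \<noteq> sin (y t / (R + 1))"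
    using sin_inj_pi[of "x t / (R+1)" "y t / (R+1)"] lim[of x] lim[of y] R t
    unfolding abs_le_iff by (smt (verit) divide_cancel_right)
  then show "\<exists>f\<in>trig_sums I. f x \<noteq> f y"
    by (intro bexI[of _ "\<lambda>x. 1 * cos ((\<Sum>i\<in>I. \<theta> i * x i) + - (pi / 2))"] trig_sums.wave)
       (simp add: s cos_diff)
qed (simp_all add: trig_sums_mult trig_sums_const trig_sums_continuous trig_sums.add)

text \<open>
  Stone-Weierstrass gives a trigonometric sum \<open>h\<close> close to \<open>f\<close> on the box, but \<open>h\<close> may be much
  larger than \<open>f\<close> elsewhere. As \<open>h\<close> is bounded, truncation at level \<open>C\<close> can be approximated on the
  range of \<open>h\<close> by a polynomial \<open>p\<close>; then \<open>p \<circ> h\<close> is again a trigonometric sum, is still close to \<open>f\<close>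
  on the box, and is bounded by \<open>C + e\<close> everywhere.
\<close>

lemma trig_sums_approximation:
  fixes f :: "(real \<Rightarrow> real) \<Rightarrow> real"
  assumes I: "finite I" and f: "continuous_map (powertop_real I) euclideanreal f"
    and C: "\<And>x. x \<in> PiE I (\<lambda>_. UNIV) \<Longrightarrow> \<bar>f x\<bar> \<le> C" and e: "0 < e"
  obtains g where "g \<in> trig_sums I" "\<And>x. \<bar>g x\<bar> \<le> C + e"
    "\<And>x. x \<in> PiE I (\<lambda>_. {- R..R}) \<Longrightarrow> \<bar>f x - g x\<bar> \<le> e"
proof -
  let ?K = "PiE I (\<lambda>_. {- R..R})"
  interpret function_ring_on "trig_sums I" ?K by (rule trig_sums_function_ring_on[OF I])
  have "continuous_map (product_topology (\<lambda>_. euclidean) UNIV) (powertop_real I) (\<lambda>x::real \<Rightarrow> real. restrict x I)"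
    by (auto simp: continuous_map_componentwise
      intro: continuous_map_product_coordinates[of _ UNIV "\<lambda>_. euclideanreal"])
  from continuous_map_compose[OF this f] have "continuous_on UNIV (\<lambda>x. f (restrict x I))"
    by (simp add: euclidean_product_topology comp_def)
  moreover have "f (restrict x I) = f x" if "x \<in> ?K" for x using that by (simp add: PiE_restrict)
  ultimately have fK: "continuous_on ?K f"
    using continuous_on_cong[OF refl, of ?K "\<lambda>x. f (restrict x I)" f]
      continuous_on_subset[of UNIV "\<lambda>x. f (restrict x I)" ?K] by blast
  obtain h where h: "h \<in> trig_sums I" and hf: "\<And>x. x \<in> ?K \<Longrightarrow> \<bar>f x - h x\<bar> < e / 2"
    using Stone_Weierstrass_basic[OF fK, of "e/2"] e by auto
  obtain D where D: "\<And>x. \<bar>h x\<bar> \<le> D" using trig_sums_bounded[OF h] by blast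
  have C0: "0 \<le> C" using C[of "restrict (\<lambda>_. 0) I"] by (auto intro: order_trans[OF abs_ge_zero])
  define clamp where "clamp y = max (- C) (min C y)" for y :: real
  have "continuous_on {- D..D} clamp"
    unfolding clamp_def by (intro continuous_intros)
  then obtain p where p: "real_polynomial_function p" "\<And>y. y \<in> {- D..D} \<Longrightarrow> \<bar>clamp y - p y\<bar> < e / 2"
    using Stone_Weierstrass_real_polynomial_function[of "{- D..D}" clamp "e/2"] e by auto
  have ph: "(\<lambda>x. p (h x)) \<in> trig_sums I"
    using p(1)
  proof induction
    case (linear f)
    then obtain c where "f = (\<lambda>x. x * c)" using real_bounded_linear by blast
    then show ?case using trig_sums_mult[OF h trig_sums_const] by simp
  qed (simp_all add: trig_sums_mult trig_sums_const trig_sums.add)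
  show thesis
  proof
    show "(\<lambda>x. p (h x)) \<in> trig_sums I" by fact
    fix x
    have *: "\<bar>clamp (h x) - p (h x)\<bar> < e / 2"
      using p(2) D[of x] by (auto simp: abs_le_iff)
    moreover have "\<bar>clamp (h x)\<bar> \<le> C" using C0 by (auto simp: clamp_def)
    ultimately show "\<bar>p (h x)\<bar> \<le> C + e" using e by linarith
    assume x: "x \<in> ?K"
    then have "\<bar>f x\<bar> \<le> C" by (intro C) (auto simp: PiE_iff)
    then have "\<bar>f x - clamp (h x)\<bar> \<le> \<bar>f x - h x\<bar>" by (auto simp: clamp_def)
    with * hf[OF x] show "\<bar>f x - p (h x)\<bar> \<le> e" by linarith
  qed
qed

lemma trig_sums_integral_tendsto:
  assumes I: "finite I"
    and \<mu>: "\<And>n. prob_space (\<mu> n)" "\<And>n. sets (\<mu> n) = sets (PiM I (\<lambda>_. borel))"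
    and \<nu>: "prob_space \<nu>" "sets \<nu> = sets (PiM I (\<lambda>_. borel))"
    and conv: "\<And>\<theta>. (\<lambda>n. CLINT x|\<mu> n. iexp (\<Sum>i\<in>I. \<theta> i * x i)) \<longlonglongrightarrow> (CLINT x|\<nu>. iexp (\<Sum>i\<in>I. \<theta> i * x i))"
    and g: "g \<in> trig_sums I"
  shows "(\<lambda>n. LINT x|\<mu> n. g x) \<longlonglongrightarrow> (LINT x|\<nu>. g x)"
  using g
proof induction
  case (wave c \<theta> b)
  have eq: "(LINT x|P. c * cos ((\<Sum>i\<in>I. \<theta> i * x i) + b)) = c * Re (cis b * (CLINT x|P. iexp (\<Sum>i\<in>I. \<theta> i * x i)))"
    if P: "prob_space P" "sets P = sets (PiM I (\<lambda>_. borel))" for P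
  proof -
    interpret P: prob_space P by fact
    note [measurable_cong] = P(2)
    have int: "integrable P (\<lambda>x. iexp (\<Sum>i\<in>I. \<theta> i * x i))"
      by (rule P.integrable_const_bound[of _ 1]) (auto simp del: of_real_sum)
    have "(LINT x|P. c * cos ((\<Sum>i\<in>I. \<theta> i * x i) + b)) = (LINT x|P. c * Re (cis b * iexp (\<Sum>i\<in>I. \<theta> i * x i)))"
      by (intro Bochner_Integration.integral_cong refl)
         (simp add: cis_conv_exp[symmetric] cis_mult add.commute del: of_real_sum)
    also have "\<dots> = c * Re (cis b * (CLINT x|P. iexp (\<Sum>i\<in>I. \<theta> i * x i)))"
      using integral_Re[OF integrable_mult_right[OF int, of "cis b"]] int
      by (simp only: integral_mult_right_zero integral_mult_right)
    finally show ?thesis .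
  qed
  show ?case
    unfolding eq[OF \<mu>] eq[OF \<nu>] by (intro tendsto_intros conv)
next
  case (add f g)
  have "(LINT x|P. f x + g x) = (LINT x|P. f x) + (LINT x|P. g x)"
    if P: "prob_space P" "sets P = sets (PiM I (\<lambda>_. borel))" for P
  proof -
    interpret P: prob_space P by fact
    have "integrable P h" if h: "h \<in> trig_sums I" for h
    proof -
      obtain C where "\<And>x. \<bar>h x\<bar> \<le> C" using trig_sums_bounded[OF h] by blast
      then show ?thesis
        using trig_sums_measurable[OF h] P(2)
        by (intro P.integrable_const_bound[of _ C]) (auto cong: measurable_cong_sets)
    qed
    then show ?thesis using add by simp
  qed
  note eq = this
  show ?case
    unfolding eq[OF \<mu>] eq[OF \<nu>] by (intro tendsto_intros add)
qed

text \<open>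
  A continuous substitute for the indicator of \<open>{y. \<bar>y\<bar> > R}\<close>, used to measure the mass outside a box.
\<close>

definition cutoff :: "real \<Rightarrow> real \<Rightarrow> real" where
  "cutoff R y = min 1 (max 0 (\<bar>y\<bar> - R))"

lemma cutoff_bounds: "0 \<le> cutoff R y" "cutoff R y \<le> 1" "R + 1 \<le> \<bar>y\<bar> \<Longrightarrow> cutoff R y = 1"
  by (auto simp: cutoff_def)

lemma cutoff_isCont: "isCont (cutoff R) y"
  unfolding cutoff_def[abs_def] by (intro continuous_intros)

lemma cutoff_measurable[measurable]: "cutoff R \<in> borel_measurable borel"
  unfolding cutoff_def[abs_def] by measurable

text \<open>
  The one-dimensional continuity theorem, applied to a single coordinate. It provides the tightness
  in the multivariate theorem below.
\<close>

lemma cutoff_integral_tendsto: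
  assumes I: "finite I" "t \<in> I"
    and \<mu>: "\<And>n. prob_space (\<mu> n)" "\<And>n. sets (\<mu> n) = sets (PiM I (\<lambda>_. borel))"
    and \<nu>: "prob_space \<nu>" "sets \<nu> = sets (PiM I (\<lambda>_. borel))"
    and conv: "\<And>\<theta>. (\<lambda>n. CLINT x|\<mu> n. iexp (\<Sum>i\<in>I. \<theta> i * x i)) \<longlonglongrightarrow> (CLINT x|\<nu>. iexp (\<Sum>i\<in>I. \<theta> i * x i))"
  shows "(\<lambda>n. LINT x|\<mu> n. cutoff R (x t)) \<longlonglongrightarrow> (LINT x|\<nu>. cutoff R (x t))"
proof -
  let ?d = "\<lambda>P. distr P borel (\<lambda>x. x t :: real)"
  have meas: "(\<lambda>x. x t) \<in> borel_measurable P" if "sets P = sets (PiM I (\<lambda>_. borel))" for P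
    using measurable_component_singleton[OF I(2), of "\<lambda>_. borel"] that by (simp cong: measurable_cong_sets)
  have rd: "real_distribution (?d P)" if "prob_space P" "sets P = sets (PiM I (\<lambda>_. borel))" for P
    using prob_space.real_distribution_distr[OF that(1) meas[OF that(2)]] by simp
  have char: "char (?d P) u = (CLINT x|P. iexp (\<Sum>i\<in>I. (if i = t then u else 0) * x i))"
    if "sets P = sets (PiM I (\<lambda>_. borel))" for P u
    unfolding char_def using meas[OF that] I
    by (subst integral_distr) (simp_all add: if_distrib[of "\<lambda>a. a * _"] cong: if_cong)
  have "weak_conv_m (\<lambda>n. ?d (\<mu> n)) (?d \<nu>)"
    by (intro levy_continuity rd \<mu> \<nu>) (simp only: char[OF \<mu>(2)] char[OF \<nu>(2)], rule conv)
  then have "(\<lambda>n. LINT y|?d (\<mu> n). cutoff R y) \<longlonglongrightarrow> (LINT y|?d \<nu>. cutoff R y)"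
    by (intro weak_conv_imp_integral_bdd_continuous_conv[of _ _ _ 1] rd \<mu> \<nu> cutoff_isCont)
       (auto simp: cutoff_bounds)
  then show ?thesis
    using meas[OF \<mu>(2)] meas[OF \<nu>(2)] by (simp add: integral_distr)
qed

text \<open>
  The multivariate continuity theorem, for a limit already known to be a probability measure. A
  bounded continuous function is approximated on a large box by a trigonometric sum with nearly the
  same bound; the integrals of trigonometric sums converge by hypothesis, and the error outside the
  box is controlled by the sum of the cutoffs of the coordinates, whose integrals converge as well
  and are small for \<open>\<nu>\<close>. The same approximation shows that \<open>f\<close> is measurable for the product
  \<open>\<sigma>\<close>-algebra.
\<close>

theorem levy_continuity_Pi:
  assumes I: "finite I"
    and \<mu>: "\<And>n. prob_space (\<mu> n)" "\<And>n. sets (\<mu> n) = sets (PiM I (\<lambda>_. borel))"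
    and \<nu>: "prob_space \<nu>" "sets \<nu> = sets (PiM I (\<lambda>_. borel))"
    and conv: "\<And>\<theta>. (\<lambda>n. CLINT x|\<mu> n. iexp (\<Sum>i\<in>I. \<theta> i * x i)) \<longlonglongrightarrow> (CLINT x|\<nu>. iexp (\<Sum>i\<in>I. \<theta> i * x i))"
  shows "weak_conv_Pi I \<mu> \<nu>"
  unfolding weak_conv_Pi_def
proof safe
  fix f assume f: "continuous_map (powertop_real I) euclideanreal f" and "bounded (f ` (I \<rightarrow>\<^sub>E UNIV))"
  then obtain C' where C': "\<And>x. x \<in> PiE I (\<lambda>_. UNIV) \<Longrightarrow> \<bar>f x\<bar> \<le> C'"
    by (auto simp: bounded_iff)
  define C where "C = max C' 0"
  have C: "\<And>x. x \<in> PiE I (\<lambda>_. UNIV) \<Longrightarrow> \<bar>f x\<bar> \<le> C" "0 \<le> C" using C' by (auto simp: C_def le_max_iff_disj)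
  define \<Phi> where "\<Phi> R x = (\<Sum>t\<in>I. cutoff R (x t))" for R and x :: "real \<Rightarrow> real"
  have \<Phi>_meas[measurable]: "\<Phi> R \<in> borel_measurable (PiM I (\<lambda>_. borel))" for R
    unfolding \<Phi>_def[abs_def] by measurable
  have \<Phi>_bounds: "0 \<le> \<Phi> R x" "\<Phi> R x \<le> card I" for R x
    unfolding \<Phi>_def
    using sum_nonneg[of I "\<lambda>t. cutoff R (x t)"] sum_bounded_above[of I "\<lambda>t. cutoff R (x t)" 1]
    by (simp_all add: cutoff_bounds)
  have \<Phi>_ge: "1 \<le> \<Phi> R x" if "x \<in> PiE I (\<lambda>_. UNIV)" "x \<notin> PiE I (\<lambda>_. {- (R+1)..R+1})" for x R
  proof -
    from that obtain t where t: "t \<in> I" "x t \<notin> {- (R+1)..R+1}" by (auto simp: PiE_iff)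
    then have t: "t \<in> I" "R + 1 \<le> \<bar>x t\<bar>" by auto
    have "cutoff R (x t) \<le> \<Phi> R x"
      unfolding \<Phi>_def using I t by (intro member_le_sum) (auto simp: cutoff_bounds)
    with t cutoff_bounds(3)[of R "x t"] show ?thesis by simp
  qed
  have space: "space P = PiE I (\<lambda>_. UNIV)" if "sets P = sets (PiM I (\<lambda>_. borel))" for P :: "(real \<Rightarrow> real) measure"
    using sets_eq_imp_space_eq[OF that] by (simp add: space_PiM)
  have f_meas: "f \<in> borel_measurable (PiM I (\<lambda>_. borel))"
  proof -
    have "\<exists>g. g \<in> trig_sums I \<and> (\<forall>x\<in>PiE I (\<lambda>_. {- real k..real k}). \<bar>f x - g x\<bar> \<le> 1 / Suc k)" for k
      by (rule trig_sums_approximation[OF I f C(1), of "1 / Suc k" "real k"]) auto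
    then obtain g where g: "\<And>k. g k \<in> trig_sums I"
      "\<And>k x. x \<in> PiE I (\<lambda>_. {- real k..real k}) \<Longrightarrow> \<bar>f x - g k x\<bar> \<le> 1 / Suc k" by metis
    show ?thesis
    proof (rule borel_measurable_LIMSEQ_real[of _ g])
      fix x assume "x \<in> space (PiM I (\<lambda>_. borel :: real measure))"
      then have x: "x \<in> PiE I (\<lambda>_. UNIV)" by (simp add: space_PiM)
      obtain k0 :: nat where k0: "(\<Sum>t\<in>I. \<bar>x t\<bar>) \<le> k0" using real_arch_simple by blast
      have "\<bar>g k x - f x\<bar> \<le> 1 / Suc k" if "k0 \<le> k" for k
      proof -
        have "\<bar>x t\<bar> \<le> real k" if "t \<in> I" for t
          using member_le_sum[of t I "\<lambda>t. \<bar>x t\<bar>"] that I k0 \<open>k0 \<le> k\<close> by simp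
        then have "x \<in> PiE I (\<lambda>_. {- real k..real k})" using x by (auto simp: PiE_iff abs_le_iff minus_le_iff)
        from g(2)[OF this] show ?thesis by (simp add: abs_minus_commute)
      qed
      then have "eventually (\<lambda>k. norm (g k x - f x) \<le> 1 / Suc k) sequentially"
        by (auto simp: eventually_sequentially)
      then have "(\<lambda>k. g k x - f x) \<longlonglongrightarrow> 0"
        by (rule Lim_null_comparison) (rule LIMSEQ_Suc[OF lim_1_over_n])
      then show "(\<lambda>k. g k x) \<longlonglongrightarrow> f x" by (rule LIM_zero_cancel)
    qed (rule trig_sums_measurable[OF g(1)])
  qed
  have approx: "\<bar>(LINT x|P. f x) - (LINT x|P. g x)\<bar> \<le> e + (2 * C + e) * (LINT x|P. \<Phi> R x)"
    if P: "prob_space P" "sets P = sets (PiM I (\<lambda>_. borel))" and e: "0 < e"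
      and g: "g \<in> trig_sums I" "\<And>x. \<bar>g x\<bar> \<le> C + e" "\<And>x. x \<in> PiE I (\<lambda>_. {- (R+1)..R+1}) \<Longrightarrow> \<bar>f x - g x\<bar> \<le> e"
    for P e R g
  proof -
    interpret P: prob_space P by fact
    note [measurable_cong] = P(2)
    note [measurable] = f_meas trig_sums_measurable[OF g(1)]
    have fi: "integrable P f" using C by (intro P.integrable_const_bound[of _ C]) (auto simp: space[OF P(2)])
    have gi: "integrable P g" using g(2) by (intro P.integrable_const_bound[of _ "C + e"]) auto
    have \<Phi>i: "integrable P (\<Phi> R)" using \<Phi>_bounds by (intro P.integrable_const_bound[of _ "card I"]) auto
    have "\<bar>(LINT x|P. f x) - (LINT x|P. g x)\<bar> = \<bar>LINT x|P. f x - g x\<bar>" using fi gi by simp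
    also have "\<dots> \<le> (LINT x|P. \<bar>f x - g x\<bar>)" by (rule integral_abs_bound)
    also have "\<dots> \<le> (LINT x|P. e + (2 * C + e) * \<Phi> R x)"
    proof (rule integral_mono)
      fix x assume "x \<in> space P"
      then have x: "x \<in> PiE I (\<lambda>_. UNIV)" by (simp add: space[OF P(2)])
      show "\<bar>f x - g x\<bar> \<le> e + (2 * C + e) * \<Phi> R x"
      proof (cases "x \<in> PiE I (\<lambda>_. {- (R+1)..R+1})")
        case True
        moreover have "0 \<le> (2 * C + e) * \<Phi> R x" using C e \<Phi>_bounds by (intro mult_nonneg_nonneg) auto
        ultimately show ?thesis using g(3)[OF True] by linarith
      next
        case False
        have "\<bar>f x - g x\<bar> \<le> 2 * C + e" using C(1)[OF x] g(2)[of x] by linarith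
        also have "\<dots> \<le> (2 * C + e) * \<Phi> R x" using \<Phi>_ge[OF x False] C e by (simp add: mult_le_cancel_left1)
        finally show ?thesis using e by linarith
      qed
    qed (use fi gi \<Phi>i in auto)
    also have "\<dots> = e + (2 * C + e) * (LINT x|P. \<Phi> R x)" using \<Phi>i by (simp add: P.prob_space)
    finally show ?thesis .
  qed
  have int_cut: "integrable P (\<lambda>x. cutoff R (x t))" if "prob_space P" "sets P = sets (PiM I (\<lambda>_. borel))" "t \<in> I" for P R t
  proof -
    interpret P: prob_space P by fact
    note [measurable_cong] = that(2) note [simp] = that(3)
    show ?thesis by (intro P.integrable_const_bound[of _ 1]) (auto simp: cutoff_bounds)
  qed
  have \<Phi>_lim: "(\<lambda>n. LINT x|\<mu> n. \<Phi> R x) \<longlonglongrightarrow> (LINT x|\<nu>. \<Phi> R x)" for R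
  proof -
    have eq: "(LINT x|P. \<Phi> R x) = (\<Sum>t\<in>I. LINT x|P. cutoff R (x t))"
      if "prob_space P" "sets P = sets (PiM I (\<lambda>_. borel))" for P
      unfolding \<Phi>_def using int_cut[OF that] by (rule Bochner_Integration.integral_sum)
    show ?thesis unfolding eq[OF \<mu>] eq[OF \<nu>]
      by (intro tendsto_sum cutoff_integral_tendsto[OF I _ \<mu> \<nu> conv])
  qed
  have \<Phi>_tail: "(\<lambda>k. LINT x|\<nu>. \<Phi> (real k) x) \<longlonglongrightarrow> (LINT x|\<nu>. 0)"
  proof (rule integral_dominated_convergence[where w = "\<lambda>_. real (card I)"])
    interpret \<nu>: prob_space \<nu> by fact
    show "integrable \<nu> (\<lambda>_. real (card I))" by simp
    show "AE x in \<nu>. (\<lambda>k. \<Phi> (real k) x) \<longlonglongrightarrow> 0"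
    proof (rule AE_I2)
      fix x
      have "(\<lambda>k. cutoff (real k) y) \<longlonglongrightarrow> 0" for y
      proof -
        obtain k0 :: nat where "\<bar>y\<bar> \<le> k0" using real_arch_simple by blast
        then have "\<forall>k\<ge>k0. cutoff (real k) y = 0" by (auto simp: cutoff_def)
        then show ?thesis by (intro tendsto_eventually) (auto simp: eventually_sequentially)
      qed
      then show "(\<lambda>k. \<Phi> (real k) x) \<longlonglongrightarrow> 0" unfolding \<Phi>_def by (intro tendsto_null_sum) auto
    qed
  qed (use \<Phi>_bounds \<Phi>_meas \<nu>(2) in \<open>auto cong: measurable_cong_sets\<close>)
  show "(\<lambda>n. LINT x|\<mu> n. f x) \<longlonglongrightarrow> (LINT x|\<nu>. f x)"
  proof (rule LIMSEQ_I)
    fix r :: real assume r: "0 < r"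
    \<comment> \<open>The total error is \<open>2 e (2 C + 2) + e = e (4 C + 5)\<close>.\<close>
    define e where "e = min 1 (r / (4 * C + 6))"
    have e: "0 < e" "e \<le> 1" "e * (4 * C + 5) < r"
    proof -
      show "0 < e" "e \<le> 1" using r C by (auto simp: e_def)
      have "e * (4 * C + 5) < e * (4 * C + 6)" using \<open>0 < e\<close> by simp
      also have "\<dots> \<le> r / (4 * C + 6) * (4 * C + 6)"
        using C by (intro mult_right_mono) (auto simp: e_def)
      also have "\<dots> = r" using C by simp
      finally show "e * (4 * C + 5) < r" .
    qed
    from order_tendstoD(2)[OF \<Phi>_tail, of e] e obtain R where R: "(LINT x|\<nu>. \<Phi> (real R) x) < e"
      by (auto simp: eventually_sequentially)
    obtain g where g: "g \<in> trig_sums I" "\<And>x. \<bar>g x\<bar> \<le> C + e"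
      "\<And>x. x \<in> PiE I (\<lambda>_. {- (real R+1)..real R+1}) \<Longrightarrow> \<bar>f x - g x\<bar> \<le> e"
      using trig_sums_approximation[OF I f C(1) e(1), of "real R + 1"] by blast
    have ap: "\<bar>(LINT x|P. f x) - (LINT x|P. g x)\<bar> \<le> e * (2 * C + 2)"
      if P: "prob_space P" "sets P = sets (PiM I (\<lambda>_. borel))" and less: "(LINT x|P. \<Phi> (real R) x) < e" for P
    proof -
      have "(2 * C + e) * (LINT x|P. \<Phi> (real R) x) \<le> (2 * C + 1) * e"
        using C e less \<Phi>_bounds by (intro mult_mono Bochner_Integration.integral_nonneg) auto
      with approx[where R = "real R", OF P e(1) g] show ?thesis by (simp add: algebra_simps)
    qed
    have "\<forall>\<^sub>F n in sequentially. (LINT x|\<mu> n. \<Phi> (real R) x) < e"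
      by (rule order_tendstoD(2)[OF \<Phi>_lim R])
    moreover have "\<forall>\<^sub>F n in sequentially. dist (LINT x|\<mu> n. g x) (LINT x|\<nu>. g x) < e"
      by (rule tendstoD[OF trig_sums_integral_tendsto[OF I \<mu> \<nu> conv g(1)] e(1)])
    ultimately have "\<forall>\<^sub>F n in sequentially. norm ((LINT x|\<mu> n. f x) - (LINT x|\<nu>. f x)) < r"
    proof eventually_elim
      case (elim n)
      then show ?case
        using ap[OF \<mu>, of n] ap[OF \<nu> R] e(3) by (simp add: dist_real_def algebra_simps)
    qed
    then show "\<exists>no. \<forall>n\<ge>no. norm ((LINT x|\<mu> n. f x) - (LINT x|\<nu>. f x)) < r"
      by (simp add: eventually_sequentially)
  qed
qed

lemma fin_dim_distr_facts:
  assumes X: "real_process P X" and I: "finite I" "I \<subseteq> {0..}"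
  shows "prob_space (fin_dim_distr P X I)" "sets (fin_dim_distr P X I) = sets (PiM I (\<lambda>_. borel))"
    "(CLINT x|fin_dim_distr P X I. iexp (\<Sum>t\<in>I. \<theta> t * x t)) = (CLINT \<omega>|P. iexp (\<Sum>t\<in>I. \<theta> t * X t \<omega>))"
proof -
  have path: "(\<lambda>\<omega>. \<lambda>t\<in>I. X t \<omega>) \<in> P \<rightarrow>\<^sub>M PiM I (\<lambda>_. borel)"
    using X I by (intro measurable_restrict) (auto simp: real_process_def)
  show "prob_space (fin_dim_distr P X I)"
    using X path unfolding fin_dim_distr_def real_process_def by (auto intro: prob_space.prob_space_distr)
  show "sets (fin_dim_distr P X I) = sets (PiM I (\<lambda>_. borel))"
    by (simp add: fin_dim_distr_def)
  have m: "(\<lambda>x. \<Sum>t\<in>I. \<theta> t * x t) \<in> borel_measurable (PiM I (\<lambda>_. borel))" by measurable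
  have "(\<lambda>x. iexp (\<Sum>t\<in>I. \<theta> t * x t)) \<in> borel_measurable (PiM I (\<lambda>_. borel))"
    by (rule measurable_compose[OF m]) measurable
  from integral_distr[OF path this]
  show "(CLINT x|fin_dim_distr P X I. iexp (\<Sum>t\<in>I. \<theta> t * x t)) = (CLINT \<omega>|P. iexp (\<Sum>t\<in>I. \<theta> t * X t \<omega>))"
    unfolding fin_dim_distr_def by (simp del: of_real_sum cong: sum.cong)
qed

lemma fdd_lim_by_iexp:
  assumes Z: "\<And>n. real_process (M n) (Z n)" and Y: "real_process L Y"
    and conv: "\<And>I \<theta>. finite I \<Longrightarrow> I \<subseteq> {0..} \<Longrightarrow>
      (\<lambda>n. CLINT \<omega>|M n. iexp (\<Sum>t\<in>I. \<theta> t * Z n t \<omega>)) \<longlonglongrightarrow> (CLINT \<omega>|L. iexp (\<Sum>t\<in>I. \<theta> t * Y t \<omega>))"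
  shows "fdd_lim M Z L Y"
  unfolding fdd_lim_def
proof (intro allI impI)
  fix I :: "real set" assume "finite I \<and> I \<subseteq> {0..}"
  then have I: "finite I" "I \<subseteq> {0..}" by auto
  show "weak_conv_Pi I (\<lambda>n. fin_dim_distr (M n) (Z n) I) (fin_dim_distr L Y I)"
  proof (rule levy_continuity_Pi[OF I(1)])
    show "(\<lambda>n. CLINT x|fin_dim_distr (M n) (Z n) I. iexp (\<Sum>t\<in>I. \<theta> t * x t))
      \<longlonglongrightarrow> (CLINT x|fin_dim_distr L Y I. iexp (\<Sum>t\<in>I. \<theta> t * x t))" for \<theta>
      unfolding fin_dim_distr_facts(3)[OF Z I] fin_dim_distr_facts(3)[OF Y I] by (rule conv[OF I])
  qed (rule fin_dim_distr_facts[OF Z I] fin_dim_distr_facts[OF Y I])+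
qed

section \<open>Centred normal laws\<close>

text \<open>
  Scaling standard normal noise treats the degenerate variance \<open>0\<close> together with the others, so that
  characteristic function and moments need no case distinction.
\<close>

lemma normal_law_eq_distr:
  assumes "0 \<le> v"
  shows "normal_law 0 v = distr std_normal_distribution borel (\<lambda>x. sqrt v * x)"
proof (cases "v = 0")
  case True
  interpret prob_space std_normal_distribution by (rule real_distribution.axioms(1)) (rule real_dist_normal_dist)
  have "distr std_normal_distribution borel (\<lambda>x. sqrt v * x) = distr std_normal_distribution borel (\<lambda>_. 0)"
    using True by (intro distr_cong) auto
  also have "\<dots> = return borel 0" by (rule distr_const) simp
  finally show ?thesis unfolding normal_law_def using True by simp
next
  case False
  interpret prob_space std_normal_distribution by (rule real_distribution.axioms(1)) (rule real_dist_normal_dist)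
  have "distributed std_normal_distribution lborel (\<lambda>x. x) std_normal_density"
    unfolding distributed_def by (intro conjI distr_id2) measurable
  from normal_density_affine[OF this, of "sqrt v" 0] False assms
  have "distributed std_normal_distribution lborel (\<lambda>x. sqrt v * x) (normal_density 0 (sqrt v))" by simp
  then have "distr std_normal_distribution lborel (\<lambda>x. sqrt v * x) = density lborel (\<lambda>x. ennreal (normal_density 0 (sqrt v) x))"
    by (simp only: distributed_def)
  moreover have "distr std_normal_distribution lborel (\<lambda>x. sqrt v * x) = distr std_normal_distribution borel (\<lambda>x. sqrt v * x)"
    by (rule distr_cong) simp_all
  ultimately show ?thesis using False by (simp only: normal_law_def if_False)
qed

lemma char_normal_law:
  assumes "0 \<le> v"
  shows "char (normal_law 0 v) t = exp (- (t\<^sup>2 * v) / 2)"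
proof -
  have "char (normal_law 0 v) t = char std_normal_distribution (t * sqrt v)"
    unfolding normal_law_eq_distr[OF assms] char_def by (subst integral_distr) (simp_all add: mult.assoc)
  then show ?thesis using assms by (simp add: char_std_normal_distribution power_mult_distrib)
qed

lemma has_bochner_integral_normal_law:
  assumes "0 \<le> v"
  shows "has_bochner_integral (normal_law 0 v) (\<lambda>x. x) 0" "has_bochner_integral (normal_law 0 v) (\<lambda>x. x\<^sup>2) v"
proof -
  have d: "has_bochner_integral std_normal_distribution f I"
    if "f \<in> borel_measurable borel" "has_bochner_integral lborel (\<lambda>x. std_normal_density x * f x) I" for f :: "real \<Rightarrow> real" and I
    using that by (intro has_bochner_integral_density) auto
  have 1: "has_bochner_integral std_normal_distribution (\<lambda>x. x) 0"
    using std_normal_moment_odd[of 0] by (intro d) auto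
  have 2: "has_bochner_integral std_normal_distribution (\<lambda>x. x\<^sup>2) 1"
    using std_normal_moment_even[of 1] by (intro d) (auto simp: fact_numeral)
  show "has_bochner_integral (normal_law 0 v) (\<lambda>x. x) 0"
    unfolding normal_law_eq_distr[OF assms]
    using has_bochner_integral_mult_right[OF 1, of "sqrt v"] by (intro has_bochner_integral_distr) auto
  show "has_bochner_integral (normal_law 0 v) (\<lambda>x. x\<^sup>2) v"
    unfolding normal_law_eq_distr[OF assms]
    using has_bochner_integral_mult_right[OF 2, of v] assms
    by (intro has_bochner_integral_distr) (auto simp: power_mult_distrib)
qed

lemma normal_moments:
  fixes Z :: "'a \<Rightarrow> real"
  assumes Z[measurable]: "Z \<in> borel_measurable M" and d: "distr M borel Z = normal_law 0 v" and v: "0 \<le> v"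
  shows "integrable M Z" "integrable M (\<lambda>x. (Z x)\<^sup>2)" "(LINT x|M. Z x) = 0" "(LINT x|M. (Z x)\<^sup>2) = v"
  using has_bochner_integral_normal_law[OF v, folded d]
  by (simp_all add: has_bochner_integral_iff integrable_distr_eq integral_distr)

lemma (in prob_space) indep_normal_sum_iexp:
  assumes ind: "indep_vars (\<lambda>_. borel) Z A" and Z: "\<And>i. i \<in> A \<Longrightarrow> distr M borel (Z i) = normal_law 0 (v i)"
    and v: "\<And>i. i \<in> A \<Longrightarrow> 0 \<le> v i"
  shows "(CLINT \<omega>|M. iexp (\<Sum>i\<in>A. b i * Z i \<omega>)) = exp (- (\<Sum>i\<in>A. (b i)\<^sup>2 * v i) / 2)"
proof -
  have rv: "random_variable borel (Z i)" if "i \<in> A" for i using ind that by (auto simp: indep_vars_def)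
  have ind': "indep_vars (\<lambda>_. borel) (\<lambda>i \<omega>. b i * Z i \<omega>) A"
    by (rule indep_vars_compose2[OF ind]) auto
  have "(CLINT \<omega>|M. iexp (\<Sum>i\<in>A. b i * Z i \<omega>)) = char (distr M borel (\<lambda>\<omega>. \<Sum>i\<in>A. b i * Z i \<omega>)) 1"
    unfolding char_def using rv by (subst integral_distr) (auto intro!: borel_measurable_sum borel_measurable_times)
  also have "\<dots> = (\<Prod>i\<in>A. char (distr M borel (\<lambda>\<omega>. b i * Z i \<omega>)) 1)"
    by (rule char_distr_sum[OF ind'])
  also have "\<dots> = (\<Prod>i\<in>A. char (distr M borel (Z i)) (b i))"
    unfolding char_def using rv by (intro prod.cong refl) (simp add: integral_distr)
  also have "\<dots> = (\<Prod>i\<in>A. of_real (exp (- ((b i)\<^sup>2 * v i) / 2)))"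
    by (intro prod.cong refl) (simp add: Z v char_normal_law)
  also have "\<dots> = of_real (exp (- (\<Sum>i\<in>A. (b i)\<^sup>2 * v i) / 2))"
    by (cases "finite A") (simp_all add: exp_sum[symmetric] sum_negf sum_divide_distrib flip: of_real_prod)
  finally show ?thesis .
qed

section \<open>Gaussian sequences with prescribed covariance\<close>

lemma integrable_mult_square:
  fixes f g :: "'a \<Rightarrow> real"
  assumes [measurable]: "f \<in> borel_measurable M" "g \<in> borel_measurable M"
    and "integrable M (\<lambda>x. (f x)\<^sup>2)" "integrable M (\<lambda>x. (g x)\<^sup>2)"
  shows "integrable M (\<lambda>x. f x * g x)"
proof (rule Bochner_Integration.integrable_bound)
  show "integrable M (\<lambda>x. (f x)\<^sup>2 + (g x)\<^sup>2)" using assms by simp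
  have "\<bar>a * b\<bar> \<le> a\<^sup>2 + b\<^sup>2" for a b :: real
    using sum_squares_bound[of "\<bar>a\<bar>" "\<bar>b\<bar>"] mult_nonneg_nonneg[of "\<bar>a\<bar>" "\<bar>b\<bar>"]
    unfolding abs_mult power2_abs by linarith
  then show "AE x in M. norm (f x * g x) \<le> norm ((f x)\<^sup>2 + (g x)\<^sup>2)"
    unfolding real_norm_def by (intro AE_I2 order_trans[OF _ abs_ge_self])
qed measurable

text \<open>
  Gram-Schmidt in \<open>L\<^sup>2\<close>: stage \<open>m\<close> holds what is left of each \<open>X k\<close> after projecting out
  \<open>X 0, \<dots>, X (m - 1)\<close>. If the \<open>m\<close>-th residual vanishes, division by \<open>0\<close> yields \<open>0\<close> and the step
  changes nothing.
\<close>

primrec gram_residual :: "'a measure \<Rightarrow> (nat \<Rightarrow> 'a \<Rightarrow> real) \<Rightarrow> nat \<Rightarrow> nat \<Rightarrow> 'a \<Rightarrow> real" where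
  "gram_residual M X 0 = X"
| "gram_residual M X (Suc m) = (\<lambda>k \<omega>. gram_residual M X m k \<omega>
     - (LINT x|M. gram_residual M X m k x * gram_residual M X m m x) / (LINT x|M. (gram_residual M X m m x)\<^sup>2)
       * gram_residual M X m m \<omega>)"

text \<open>
  The Cholesky factorisation of the infinite matrix of inner products. Step \<open>m\<close> of Gram-Schmidt splits
  off a matrix of rank one, and after \<open>n\<close> steps the residuals of \<open>X 0, \<dots>, X (n - 1)\<close> vanish.
\<close>

lemma gram_factorisation:
  fixes X :: "nat \<Rightarrow> 'a \<Rightarrow> real"
  assumes meas: "\<And>k. X k \<in> borel_measurable M" and sq: "\<And>k. integrable M (\<lambda>x. (X k x)\<^sup>2)"
  shows "\<exists>c. \<forall>n k l. k < n \<longrightarrow> (LINT x|M. X k x * X l x) = (\<Sum>i<n. c k i * c l i)"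
proof -
  let ?R = "gram_residual M X"
  define K where "K m k l = (LINT x|M. ?R m k x * ?R m l x)" for m k l
  define c where "c k m = K m k m / sqrt (K m m m)" for k m
  have inv: "?R m k \<in> borel_measurable M \<and> integrable M (\<lambda>x. (?R m k x)\<^sup>2)" for m k
  proof (induction m arbitrary: k)
    case (Suc m)
    note [measurable] = Suc[THEN conjunct1]
    define a where "a = K m k m / K m m m"
    have eq: "?R (Suc m) k = (\<lambda>\<omega>. ?R m k \<omega> - a * ?R m m \<omega>)"
      by (simp add: a_def K_def power2_eq_square)
    have "integrable M (\<lambda>x. (?R m k x)\<^sup>2 - 2 * a * (?R m k x * ?R m m x) + a\<^sup>2 * (?R m m x)\<^sup>2)"
      using Suc by (intro Bochner_Integration.integrable_add Bochner_Integration.integrable_diff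
        integrable_mult_right integrable_mult_square) auto
    also have "(\<lambda>x. (?R m k x)\<^sup>2 - 2 * a * (?R m k x * ?R m m x) + a\<^sup>2 * (?R m m x)\<^sup>2)
      = (\<lambda>x. (?R m k x - a * ?R m m x)\<^sup>2)" by (simp add: power2_eq_square algebra_simps)
    finally show ?case unfolding eq by simp
  qed (simp add: meas sq)
  note [measurable] = inv[THEN conjunct1]
  have int: "integrable M (\<lambda>x. ?R m k x * ?R m l x)" for m k l
    using inv by (intro integrable_mult_square) auto
  have sym: "K m k l = K m l k" for m k l by (simp add: K_def mult.commute)
  have nonneg: "0 \<le> K m m m" for m by (simp add: K_def)
  have degenerate: "AE x in M. ?R m m x = 0" if "K m m m = 0" for m
  proof -
    have "AE x in M. ?R m m x * ?R m m x = 0"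
      using that integral_nonneg_eq_0_iff_AE[OF int[of m m m]] by (simp add: K_def)
    then show ?thesis by simp
  qed
  have zero: "K m k l = 0" if "AE x in M. ?R m k x = 0" for m k l
  proof -
    have "K m k l = (LINT x|M. 0)" unfolding K_def using that by (intro integral_cong_AE) auto
    then show ?thesis by simp
  qed
  have step: "K m k l = c k m * c l m + K (Suc m) k l" for m k l
  proof (cases "K m m m = 0")
    case True
    then show ?thesis by (simp add: c_def K_def power2_eq_square)
  next
    case False
    define a b where "a = K m k m / K m m m" and "b = K m l m / K m m m"
    have "K (Suc m) k l = (LINT x|M. ?R m k x * ?R m l x - b * (?R m k x * ?R m m x) - a * (?R m l x * ?R m m x)
        + a * b * (?R m m x * ?R m m x))"
      unfolding K_def by (intro Bochner_Integration.integral_cong refl)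
        (simp add: a_def b_def K_def algebra_simps power2_eq_square)
    also have "\<dots> = K m k l - b * K m k m - a * K m l m + a * b * K m m m"
      by (simp add: K_def int)
    also have "\<dots> = K m k l - K m k m * K m l m / K m m m"
      using False by (simp add: a_def b_def field_simps)
    also have "K m k m * K m l m / K m m m = c k m * c l m"
      using nonneg[of m] by (simp add: c_def)
    finally show ?thesis by simp
  qed
  have vanish: "AE x in M. ?R m k x = 0" if "k < m" for k m
    using that
  proof (induction m)
    case (Suc m)
    show ?case
    proof (cases "k < m")
      case True
      with zero[OF Suc.IH[OF True], of m] Suc.IH show ?thesis by (simp add: K_def)
    next
      case False
      with Suc.prems have "k = m" by simp
      show ?thesis
      proof (cases "K m m m = 0")
        case True
        with degenerate[OF True] show ?thesis by (auto simp: \<open>k = m\<close>)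
      next
        case False
        then show ?thesis by (simp add: \<open>k = m\<close> K_def power2_eq_square)
      qed
    qed
  qed simp
  have expand: "K 0 k l = (\<Sum>i<n. c k i * c l i) + K n k l" for n k l
  proof (induction n)
    case (Suc n)
    then show ?case using step[of n k l] by simp
  qed simp
  then have "K 0 k l = (\<Sum>i<n. c k i * c l i)" if "k < n" for n k l
    using zero[OF vanish[OF that]] expand[of k l n] by simp
  then show ?thesis by (intro exI[of _ c]) (simp add: K_def)
qed

text \<open>
  Independent standard normal variables. They are indexed by the reals because the processes of the
  inner limit live on \<open>real \<Rightarrow> real\<close>; only the coordinates at natural numbers will be read.
\<close>

definition normal_noise :: "(real \<Rightarrow> real) measure" where
  "normal_noise = PiM UNIV (\<lambda>_. std_normal_distribution)"

lemma prob_space_normal_noise: "prob_space normal_noise"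
  unfolding normal_noise_def by (intro prob_space_PiM prob_space_normal_density) simp

lemma distr_normal_noise_coordinate: "distr normal_noise borel (\<lambda>\<omega>. \<omega> t) = normal_law 0 1"
proof -
  have "distr normal_noise borel (\<lambda>\<omega>. \<omega> t) = distr normal_noise std_normal_distribution (\<lambda>\<omega>. \<omega> t)"
    by (intro distr_cong) auto
  also have "\<dots> = std_normal_distribution"
    unfolding normal_noise_def by (intro distr_PiM_component prob_space_normal_density) auto
  finally show ?thesis by (simp add: normal_law_def)
qed

lemma indep_vars_normal_noise: "prob_space.indep_vars normal_noise (\<lambda>_. borel) (\<lambda>t \<omega>. \<omega> t) UNIV"
proof -
  interpret prob_space normal_noise by (rule prob_space_normal_noise)
  have s: "sets normal_noise = sets (PiM UNIV (\<lambda>_. borel))"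
    unfolding normal_noise_def by (intro sets_PiM_cong) auto
  have "distr normal_noise (PiM UNIV (\<lambda>_. borel)) (\<lambda>\<omega>. \<omega>) = normal_noise"
    using s by (intro distr_id2) auto
  also have "normal_noise = PiM UNIV (\<lambda>t. distr normal_noise borel (\<lambda>\<omega>. \<omega> t))"
    unfolding distr_normal_noise_coordinate by (simp add: normal_noise_def normal_law_def)
  finally show ?thesis
    by (subst indep_vars_iff_distr_eq_PiM') (auto simp: measurable_cong_sets[OF s refl] restrict_def)
qed

lemma (in prob_space) indep_vars_inj_reindex:
  assumes ind: "indep_vars M' U J" and f: "inj_on f I" "f ` I \<subseteq> J"
  shows "indep_vars (\<lambda>i. M' (f i)) (\<lambda>i. U (f i)) I"
  unfolding indep_vars_def
proof (intro conjI ballI indep_setsI)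
  show "random_variable (M' (f i)) (U (f i))" if "i \<in> I" for i
    using ind f that by (auto simp: indep_vars_def)
  let ?G = "\<lambda>j. sigma_sets (space M) {U j -` A \<inter> space M |A. A \<in> sets (M' j)}"
  have G: "indep_sets ?G J" using ind by (simp add: indep_vars_def)
  show "?G (f i) \<subseteq> events" if "i \<in> I" for i
    using G f that by (auto simp: indep_sets_def)
  fix A K assume K: "K \<noteq> {}" "K \<subseteq> I" "finite K" and A: "\<forall>j\<in>K. A j \<in> ?G (f j)"
  have inj: "inj_on f K" using f K by (auto intro: inj_on_subset)
  define B where "B j = A (the_inv_into K f j)" for j
  have B: "B (f i) = A i" if "i \<in> K" for i using that inj by (simp add: B_def the_inv_into_f_f)
  have "prob (\<Inter>j\<in>f ` K. B j) = (\<Prod>j\<in>f ` K. prob (B j))"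
  proof (rule indep_setsD[OF G])
    show "f ` K \<subseteq> J" using K f by blast
    show "\<forall>j\<in>f ` K. B j \<in> ?G j" using A B by auto
  qed (use K in auto)
  then show "prob (\<Inter>j\<in>K. A j) = (\<Prod>j\<in>K. prob (A j))"
    using B by (simp add: prod.reindex[OF inj] image_image cong: INF_cong)
qed

text \<open>
  The Cholesky factor, applied to independent standard normal variables, gives a Gaussian sequence
  with the covariance of \<open>X\<close>. The factor is triangular, so every term is a finite sum of
  coordinates of the noise, and all terms live on one space.
\<close>

lemma gaussian_sequence_exists:
  fixes X :: "nat \<Rightarrow> 'a \<Rightarrow> real"
  assumes X: "\<And>k. X k \<in> borel_measurable M" and sq: "\<And>k. integrable M (\<lambda>\<omega>. (X k \<omega>)\<^sup>2)"
  obtains G :: "nat \<Rightarrow> (real \<Rightarrow> real) \<Rightarrow> real"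
    where "\<And>k. G k \<in> borel_measurable normal_noise"
      "\<And>m w. (CLINT \<omega>|normal_noise. iexp (\<Sum>k<m. w k * G k \<omega>))
        = of_real (exp (- (\<Sum>k<m. \<Sum>l<m. w k * w l * (LINT \<omega>|M. X k \<omega> * X l \<omega>)) / 2))"
proof -
  interpret noise: prob_space normal_noise by (rule prob_space_normal_noise)
  obtain c where c: "\<And>n k l. k < n \<Longrightarrow> (LINT \<omega>|M. X k \<omega> * X l \<omega>) = (\<Sum>i<n. c k i * c l i)"
    using gram_factorisation[of X M] X sq by blast
  \<comment> \<open>The diagonal entry \<open>k\<close> is the same sum of squares for all lengths exceeding \<open>k\<close>, so the later squares vanish.\<close>
  have c0: "c k i = 0" if "k < i" for k i
    using c[of k i k] c[of k "Suc i" k] that by simp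
  define G where "G k \<omega> = (\<Sum>i\<le>k. c k i * \<omega> (real i))" for k and \<omega> :: "real \<Rightarrow> real"
  show thesis
  proof
    show "G k \<in> borel_measurable normal_noise" for k
      unfolding G_def[abs_def] normal_noise_def by measurable
    fix m :: nat and w :: "nat \<Rightarrow> real"
    define b where "b i = (\<Sum>k<m. w k * c k i)" for i
    have G_eq: "G k \<omega> = (\<Sum>i<m. c k i * \<omega> (real i))" if "k < m" for k \<omega>
      unfolding G_def using that c0 by (intro sum.mono_neutral_left) auto
    have "(\<Sum>k<m. w k * G k \<omega>) = (\<Sum>i<m. b i * \<omega> (real i))" for \<omega>
    proof -
      have "(\<Sum>k<m. w k * G k \<omega>) = (\<Sum>k<m. \<Sum>i<m. w k * c k i * \<omega> (real i))"
        by (simp add: G_eq sum_distrib_left mult.assoc)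
      also have "\<dots> = (\<Sum>i<m. \<Sum>k<m. w k * c k i * \<omega> (real i))" by (rule sum.swap)
      finally show ?thesis by (simp add: b_def sum_distrib_right)
    qed
    moreover have "(CLINT \<omega>|normal_noise. iexp (\<Sum>i<m. b i * \<omega> (real i))) = of_real (exp (- (\<Sum>i<m. (b i)\<^sup>2 * 1) / 2))"
    proof (rule noise.indep_normal_sum_iexp)
      show "noise.indep_vars (\<lambda>_. borel) (\<lambda>i \<omega>. \<omega> (real i)) {..<m}"
        by (rule noise.indep_vars_inj_reindex[OF indep_vars_normal_noise]) (auto simp: inj_on_def)
    qed (simp_all add: distr_normal_noise_coordinate)
    moreover have "(\<Sum>i<m. (b i)\<^sup>2 * 1) = (\<Sum>k<m. \<Sum>l<m. w k * w l * (LINT \<omega>|M. X k \<omega> * X l \<omega>))"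
    proof -
      have "(\<Sum>i<m. (b i)\<^sup>2 * 1) = (\<Sum>i<m. \<Sum>k<m. \<Sum>l<m. w k * w l * (c k i * c l i))"
        by (simp add: b_def power2_eq_square sum_product ac_simps)
      also have "\<dots> = (\<Sum>k<m. \<Sum>l<m. \<Sum>i<m. w k * w l * (c k i * c l i))"
        by (rule trans[OF sum.swap]) (intro sum.cong refl sum.swap)
      also have "\<dots> = (\<Sum>k<m. \<Sum>l<m. w k * w l * (LINT \<omega>|M. X k \<omega> * X l \<omega>))"
        by (intro sum.cong refl) (simp add: c[of _ m] sum_distrib_left)
      finally show ?thesis .
    qed
    ultimately show "(CLINT \<omega>|normal_noise. iexp (\<Sum>k<m. w k * G k \<omega>))
        = of_real (exp (- (\<Sum>k<m. \<Sum>l<m. w k * w l * (LINT \<omega>|M. X k \<omega> * X l \<omega>)) / 2))"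
      by simp
  qed
qed

section \<open>Second moments of the stationary AR(1) process\<close>

lemma strictly_stationary_marginal:
  assumes "strictly_stationary M X"
  shows "distr M borel (X k) = distr M borel (X 0)"
proof -
  have X[measurable]: "X k \<in> borel_measurable M" for k
    using assms by (auto simp: strictly_stationary_def)
  have "distr M borel (X k) = distr (distr M seq0_space (\<lambda>\<omega> i. X (i + k) \<omega>)) borel (\<lambda>w. w 0)"
    by (subst distr_distr) (auto simp: comp_def intro!: measurable_PiM_single')
  also have "\<dots> = distr (distr M seq0_space (\<lambda>\<omega> i. X i \<omega>)) borel (\<lambda>w. w 0)"
    using assms by (simp add: strictly_stationary_def)
  also have "\<dots> = distr M borel (X 0)"
    by (subst distr_distr) (auto simp: comp_def intro!: measurable_PiM_single')
  finally show ?thesis .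
qed

lemma (in prob_space) indep_pair_imp_indep_var:
  assumes UV: "indep_pair M S U T V" and f: "f \<in> S \<rightarrow>\<^sub>M N1" and g: "g \<in> T \<rightarrow>\<^sub>M N2"
  shows "indep_var N1 (\<lambda>\<omega>. f (U \<omega>)) N2 (\<lambda>\<omega>. g (V \<omega>))"
proof -
  have U: "U \<in> M \<rightarrow>\<^sub>M S" and V: "V \<in> M \<rightarrow>\<^sub>M T"
    and ind: "indep_set {U -` A \<inter> space M | A. A \<in> sets S} {V -` A \<inter> space M | A. A \<in> sets T}"
    using UV by (auto simp: indep_pair_def)
  have fU: "(\<lambda>\<omega>. f (U \<omega>)) \<in> M \<rightarrow>\<^sub>M N1" and gV: "(\<lambda>\<omega>. g (V \<omega>)) \<in> M \<rightarrow>\<^sub>M N2"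
    using U V f g by measurable
  have pre: "\<exists>B\<in>sets S. (\<lambda>\<omega>. h (U \<omega>)) -` A \<inter> space M = U -` B \<inter> space M"
    if "U \<in> M \<rightarrow>\<^sub>M S" "h \<in> S \<rightarrow>\<^sub>M N" "A \<in> sets N" for h A N S and U :: "'a \<Rightarrow> 'x"
    using that by (intro bexI[of _ "h -` A \<inter> space S"]) (auto dest: measurable_space measurable_sets)
  show ?thesis unfolding indep_var_eq
  proof (intro conjI indep_set_sigma_sets fU gV)
    show "indep_set {(\<lambda>\<omega>. f (U \<omega>)) -` A \<inter> space M |A. A \<in> sets N1}
        {(\<lambda>\<omega>. g (V \<omega>)) -` A \<inter> space M |A. A \<in> sets N2}"
    proof (rule indep_setI)
      fix a b assume "a \<in> {(\<lambda>\<omega>. f (U \<omega>)) -` A \<inter> space M |A. A \<in> sets N1}"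
        and "b \<in> {(\<lambda>\<omega>. g (V \<omega>)) -` A \<inter> space M |A. A \<in> sets N2}"
      then have "a \<in> {U -` A \<inter> space M | A. A \<in> sets S}" "b \<in> {V -` A \<inter> space M | A. A \<in> sets T}"
        using pre[OF U f] pre[OF V g] by (smt (verit) mem_Collect_eq)+
      then show "prob (a \<inter> b) = prob a * prob b" by (rule indep_setD[OF ind])
    qed (use fU gV in \<open>auto intro: measurable_sets\<close>)
    show "Int_stable {(\<lambda>\<omega>. f (U \<omega>)) -` A \<inter> space M |A. A \<in> sets N1}"
      "Int_stable {(\<lambda>\<omega>. g (V \<omega>)) -` A \<inter> space M |A. A \<in> sets N2}"
      unfolding Int_stable_def by (safe; rule_tac x="A \<inter> Aa" in exI; auto)+
  qed
qed

lemma (in prob_space) indep_zero_mean_product: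
  fixes U V :: "'a \<Rightarrow> real"
  assumes "indep_var borel U borel V" "integrable M U" "integrable M V" "expectation V = 0"
  shows "expectation (\<lambda>\<omega>. U \<omega> * V \<omega>) = 0"
  using indep_var_lebesgue_integral[OF assms(1,2,3)] assms(4) by simp

lemma convex_square_bound:
  fixes a x e :: real
  assumes "0 \<le> a" "a < 1"
  shows "(a * x + e)\<^sup>2 \<le> a * x\<^sup>2 + e\<^sup>2 / (1 - a)"
proof -
  have "a * x\<^sup>2 + e\<^sup>2 / (1 - a) - (a * x + e)\<^sup>2 = a * ((1 - a) * x - e)\<^sup>2 / (1 - a)"
    using assms by (simp add: field_simps power2_eq_square)
  also have "\<dots> \<ge> 0" using assms by simp
  finally show ?thesis by simp
qed

text \<open>
  Stationarity together with the variance of the innovations bounds the truncated second moments. Since \<open>X 1 = a X 0 + \<epsilon> 1\<close> has the law of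
  \<open>X 0\<close>, convexity gives \<open>E min (c X\<^sub>0\<^sup>2) K \<le> E min (a c X\<^sub>0\<^sup>2) K + c v / (1 - a)\<close>. Iteration from \<open>c = 1\<close>
  produces the factors \<open>c = a\<^sup>i\<close>, whose truncated moments tend to \<open>0\<close>, and a geometric series, hence a
  bound on \<open>E min X\<^sub>0\<^sup>2 K\<close> that is uniform in \<open>K\<close>.
\<close>

lemma stationary_ar1_square_integrable:
  assumes ar: "stationary_ar1 M a v X \<epsilon>" and a: "0 \<le> a" "a < 1" and v: "0 \<le> v"
  shows "integrable M (\<lambda>\<omega>. (X 0 \<omega>)\<^sup>2)"
proof -
  interpret prob_space M using ar by (simp add: stationary_ar1_def)
  have X[measurable]: "X k \<in> borel_measurable M" for k
    using ar by (auto simp: stationary_ar1_def strictly_stationary_def)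
  have \<epsilon>[measurable]: "\<epsilon> 1 \<in> borel_measurable M"
    using ar by (auto simp: stationary_ar1_def gaussian_innovations_def indep_vars_def)
  have d1: "distr M borel (X 1) = distr M borel (X 0)"
    using ar by (intro strictly_stationary_marginal) (simp add: stationary_ar1_def)
  have rec: "AE \<omega> in M. X 1 \<omega> = a * X 0 \<omega> + \<epsilon> 1 \<omega>"
  proof -
    have "\<forall>k\<ge>1. AE \<omega> in M. X k \<omega> = a * X (k - 1) \<omega> + \<epsilon> k \<omega>"
      using ar by (simp add: stationary_ar1_def)
    from this[THEN spec, of 1] show ?thesis by simp
  qed
  have e: "integrable M (\<lambda>x. (\<epsilon> 1 x)\<^sup>2)" "(LINT x|M. (\<epsilon> 1 x)\<^sup>2) = v"
    using normal_moments[OF \<epsilon> _ v] ar by (simp_all add: stationary_ar1_def gaussian_innovations_def)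
  define m where "m K c = expectation (\<lambda>\<omega>. min (c * (X 0 \<omega>)\<^sup>2) K)" for K c
  have mint: "integrable M (\<lambda>\<omega>. min (c * (X k \<omega>)\<^sup>2) K)" if "0 \<le> K" "0 \<le> c" for K c k
    using that by (intro integrable_const_bound[of _ K]) auto
  have step: "m K (a ^ i) \<le> m K (a ^ Suc i) + a ^ i * v / (1 - a)" if K: "0 \<le> K" for K i
  proof -
    have "m K (a ^ i) = expectation (\<lambda>\<omega>. min (a ^ i * (X 1 \<omega>)\<^sup>2) K)"
    proof -
      have "m K (a ^ i) = (LINT x|distr M borel (X 0). min (a ^ i * x\<^sup>2) K)"
        unfolding m_def by (subst integral_distr) auto
      also have "\<dots> = expectation (\<lambda>\<omega>. min (a ^ i * (X 1 \<omega>)\<^sup>2) K)"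
        unfolding d1[symmetric] by (subst integral_distr) auto
      finally show ?thesis .
    qed
    also have "\<dots> \<le> expectation (\<lambda>\<omega>. min (a ^ Suc i * (X 0 \<omega>)\<^sup>2) K + a ^ i * (\<epsilon> 1 \<omega>)\<^sup>2 / (1 - a))"
    proof (rule integral_mono_AE)
      show "AE \<omega> in M. min (a ^ i * (X 1 \<omega>)\<^sup>2) K \<le> min (a ^ Suc i * (X 0 \<omega>)\<^sup>2) K + a ^ i * (\<epsilon> 1 \<omega>)\<^sup>2 / (1 - a)"
        using rec
      proof eventually_elim
        case (elim \<omega>)
        have "a ^ i * (X 1 \<omega>)\<^sup>2 \<le> a ^ i * (a * (X 0 \<omega>)\<^sup>2 + (\<epsilon> 1 \<omega>)\<^sup>2 / (1 - a))"
          unfolding elim using a by (intro mult_left_mono convex_square_bound) auto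
        also have "\<dots> = a ^ Suc i * (X 0 \<omega>)\<^sup>2 + a ^ i * (\<epsilon> 1 \<omega>)\<^sup>2 / (1 - a)"
          by (simp add: algebra_simps)
        finally have "a ^ i * (X 1 \<omega>)\<^sup>2 \<le> a ^ Suc i * (X 0 \<omega>)\<^sup>2 + a ^ i * (\<epsilon> 1 \<omega>)\<^sup>2 / (1 - a)" .
        moreover have "0 \<le> a ^ i * (\<epsilon> 1 \<omega>)\<^sup>2 / (1 - a)" using a by simp
        ultimately show ?case by linarith
      qed
    qed (use K a e mint[of K "a ^ i" 1] mint[of K "a ^ Suc i" 0] in auto)
    also have "\<dots> = m K (a ^ Suc i) + a ^ i * v / (1 - a)"
      using K a e mint[of K "a ^ Suc i" 0] by (simp add: m_def)
    finally show ?thesis .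
  qed
  have iterate: "m K 1 \<le> m K (a ^ n) + (\<Sum>i<n. a ^ i) * v / (1 - a)" if K: "0 \<le> K" for K n
  proof (induction n)
    case (Suc n)
    with step[OF K, of n] show ?case by (simp add: algebra_simps add_divide_distrib)
  qed simp
  \<comment> \<open>Letting the number of iterations tend to infinity: \<open>m K (a ^ n)\<close> vanishes.\<close>
  have bound: "m K 1 \<le> (1 / (1 - a)) * v / (1 - a)" if K: "0 \<le> K" for K
  proof (rule LIMSEQ_le_const)
    have "(\<lambda>n. m K (a ^ n)) \<longlonglongrightarrow> expectation (\<lambda>\<omega>. min (0 * (X 0 \<omega>)\<^sup>2) K)"
      unfolding m_def
    proof (rule integral_dominated_convergence[where w = "\<lambda>_. K"])
      show "AE \<omega> in M. (\<lambda>n. min (a ^ n * (X 0 \<omega>)\<^sup>2) K) \<longlonglongrightarrow> min (0 * (X 0 \<omega>)\<^sup>2) K"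
        using a by (intro AE_I2 tendsto_intros LIMSEQ_realpow_zero) auto
    qed (use K a in auto)
    moreover have "(\<lambda>n. (\<Sum>i<n. a ^ i)) \<longlonglongrightarrow> 1 / (1 - a)"
      using geometric_sums[of a] a by (simp add: sums_def)
    ultimately show "(\<lambda>n. m K (a ^ n) + (\<Sum>i<n. a ^ i) * v / (1 - a)) \<longlonglongrightarrow> (1 / (1 - a)) * v / (1 - a)"
      using K a by (auto intro!: tendsto_eq_intros)
  qed (use iterate[OF K] in auto)
  have mono: "incseq (\<lambda>n. m (real n) 1)"
    unfolding incseq_def m_def
    by (intro allI impI integral_mono) (use mint[of _ 1 0] in auto)
  have "\<forall>n. m (real n) 1 \<le> (1 / (1 - a)) * v / (1 - a)" using bound by simp
  from incseq_convergent[OF mono this] obtain L where L: "(\<lambda>n. m (real n) 1) \<longlonglongrightarrow> L" by blast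
  show ?thesis
  proof (rule integral_monotone_convergence_nonneg(1))
    show "AE x in M. mono (\<lambda>n. min (1 * (X 0 x)\<^sup>2) (real n))" by (auto simp: mono_def)
    show "AE x in M. (\<lambda>n. min (1 * (X 0 x)\<^sup>2) (real n)) \<longlonglongrightarrow> (X 0 x)\<^sup>2"
    proof (rule AE_I2)
      fix x
      obtain n0 :: nat where "(X 0 x)\<^sup>2 \<le> n0" using real_arch_simple by blast
      then have "\<forall>n\<ge>n0. min (1 * (X 0 x)\<^sup>2) (real n) = (X 0 x)\<^sup>2" by (auto simp: min_def)
      then show "(\<lambda>n. min (1 * (X 0 x)\<^sup>2) (real n)) \<longlonglongrightarrow> (X 0 x)\<^sup>2"
        by (intro tendsto_eventually) (auto simp: eventually_sequentially)
    qed
    show "(\<lambda>n. expectation (\<lambda>x. min (1 * (X 0 x)\<^sup>2) (real n))) \<longlonglongrightarrow> L" using L by (simp add: m_def)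
  qed (use mint[of _ 1 0] in auto)
qed

text \<open>
  With square integrability established, the recursion determines everything: later innovations are
  orthogonal to \<open>X k\<close>, the mean and the variance solve the fixed point equations \<open>m = a m\<close> and
  \<open>s = a\<^sup>2 s + v\<close>, and each further lag contributes a factor \<open>a\<close>. The exponent \<open>k - l + (l - k)\<close>, with
  truncated subtraction, is \<open>\<bar>k - l\<bar>\<close>.
\<close>

lemma stationary_ar1_moments:
  assumes ar: "stationary_ar1 M a v X \<epsilon>" and a: "0 \<le> a" "a < 1" and v: "0 \<le> v"
  shows "integrable M (\<lambda>\<omega>. (X k \<omega>)\<^sup>2)"
    and "(LINT \<omega>|M. X k \<omega>) = 0"
    and "(LINT \<omega>|M. X k \<omega> * X l \<omega>) = a ^ (k - l + (l - k)) * v / (1 - a\<^sup>2)"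
proof -
  interpret prob_space M using ar by (simp add: stationary_ar1_def)
  have st: "strictly_stationary M X" and inn: "gaussian_innovations M v \<epsilon>"
    and ip: "indep_pair M borel (X 0) seq1_space (\<lambda>\<omega>. \<lambda>k\<in>{1..}. \<epsilon> k \<omega>)"
    and rec': "\<forall>k\<ge>1. AE \<omega> in M. X k \<omega> = a * X (k - 1) \<omega> + \<epsilon> k \<omega>"
    using ar by (simp_all add: stationary_ar1_def)
  have X[measurable]: "X k \<in> borel_measurable M" for k
    using st by (simp add: strictly_stationary_def)
  have ind: "indep_vars (\<lambda>_. borel) \<epsilon> {1..}" using inn by (simp add: gaussian_innovations_def)
  have \<epsilon>[measurable]: "\<epsilon> (Suc k) \<in> borel_measurable M" for k
    using ind by (simp add: indep_vars_def)
  have rec: "AE \<omega> in M. X (Suc k) \<omega> = a * X k \<omega> + \<epsilon> (Suc k) \<omega>" for k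
    using rec'[THEN spec, of "Suc k"] by simp
  have d: "distr M borel (\<epsilon> (Suc k)) = normal_law 0 v" for k
    using inn by (simp add: gaussian_innovations_def)
  note e = normal_moments[OF \<epsilon> d v]
  have same: "(LINT \<omega>|M. g (X k \<omega>)) = (LINT \<omega>|M. g (X 0 \<omega>))"
    "integrable M (\<lambda>\<omega>. g (X k \<omega>)) = integrable M (\<lambda>\<omega>. g (X 0 \<omega>))"
    if [measurable]: "g \<in> borel_measurable borel" for g :: "real \<Rightarrow> real" and k
  proof -
    have "(LINT \<omega>|M. g (X j \<omega>)) = (LINT x|distr M borel (X j). g x)" for j
      by (simp add: integral_distr)
    from this[of k] this[of 0] show "(LINT \<omega>|M. g (X k \<omega>)) = (LINT \<omega>|M. g (X 0 \<omega>))"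
      unfolding strictly_stationary_marginal[OF st, of k] by simp
    have "integrable M (\<lambda>\<omega>. g (X j \<omega>)) = integrable (distr M borel (X j)) g" for j
      by (simp add: integrable_distr_eq)
    from this[of k] this[of 0] show "integrable M (\<lambda>\<omega>. g (X k \<omega>)) = integrable M (\<lambda>\<omega>. g (X 0 \<omega>))"
      unfolding strictly_stationary_marginal[OF st, of k] by simp
  qed
  have sq: "integrable M (\<lambda>\<omega>. (X k \<omega>)\<^sup>2)" for k
    using same(2)[of "\<lambda>x. x\<^sup>2"] stationary_ar1_square_integrable[OF ar a v] by simp
  then show "integrable M (\<lambda>\<omega>. (X k \<omega>)\<^sup>2)" .
  have i1: "integrable M (X k)" for k
    by (rule square_integrable_imp_integrable[OF _ sq]) simp
  have ee: "expectation (\<lambda>\<omega>. \<epsilon> (Suc i) \<omega> * \<epsilon> (Suc j) \<omega>) = 0" if "i \<noteq> j" for i j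
  proof -
    have "indep_vars (\<lambda>_. borel) \<epsilon> (insert (Suc i) {Suc j})"
      by (rule indep_vars_subset[OF ind]) auto
    from indep_vars_sum[OF _ _ this] that have "indep_var borel (\<epsilon> (Suc i)) borel (\<epsilon> (Suc j))" by simp
    then show ?thesis by (intro indep_zero_mean_product e)
  qed
  have e_iv: "indep_var borel (X 0) borel (\<epsilon> (Suc j))" for j
    using indep_pair_imp_indep_var[OF ip, of "\<lambda>x. x" borel "\<lambda>w. w (Suc j)" borel] by simp
  have xe_int: "integrable M (\<lambda>\<omega>. X k \<omega> * \<epsilon> (Suc j) \<omega>)" for k j
    by (intro integrable_mult_square sq e) auto
  have ee_int: "integrable M (\<lambda>\<omega>. \<epsilon> (Suc k) \<omega> * \<epsilon> (Suc j) \<omega>)" for k j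
    by (intro integrable_mult_square e) auto
  have xx_int: "integrable M (\<lambda>\<omega>. X k \<omega> * X j \<omega>)" for k j
    by (intro integrable_mult_square sq) auto
  have xe: "expectation (\<lambda>\<omega>. X k \<omega> * \<epsilon> (Suc j) \<omega>) = 0" if "k \<le> j" for k j
    using that
  proof (induction k)
    case 0
    show ?case by (intro indep_zero_mean_product e_iv i1 e)
  next
    case (Suc k)
    have "expectation (\<lambda>\<omega>. X (Suc k) \<omega> * \<epsilon> (Suc j) \<omega>)
      = expectation (\<lambda>\<omega>. a * (X k \<omega> * \<epsilon> (Suc j) \<omega>) + \<epsilon> (Suc k) \<omega> * \<epsilon> (Suc j) \<omega>)"
      using rec[of k] by (intro integral_cong_AE) (auto simp: algebra_simps)
    also have "\<dots> = 0" using Suc xe_int ee_int ee[of k j] by simp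
    finally show ?case .
  qed
  have mean0: "expectation (X 0) = 0"
  proof -
    have "expectation (X (Suc 0)) = expectation (\<lambda>\<omega>. a * X 0 \<omega> + \<epsilon> (Suc 0) \<omega>)"
      using rec[of 0] by (intro integral_cong_AE) auto
    also have "\<dots> = a * expectation (X 0)" using i1 e by simp
    finally have "(1 - a) * expectation (X 0) = 0"
      using same(1)[of "\<lambda>x. x" "Suc 0"] by (simp add: algebra_simps)
    then show ?thesis using a by simp
  qed
  then show "expectation (X k) = 0" using same(1)[of "\<lambda>x. x" k] by simp
  have var: "expectation (\<lambda>\<omega>. X k \<omega> * X k \<omega>) = v / (1 - a\<^sup>2)" for k
  proof -
    let ?s = "expectation (\<lambda>\<omega>. (X 0 \<omega>)\<^sup>2)"
    have "expectation (\<lambda>\<omega>. (X (Suc 0) \<omega>)\<^sup>2)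
      = expectation (\<lambda>\<omega>. a\<^sup>2 * (X 0 \<omega>)\<^sup>2 + 2 * a * (X 0 \<omega> * \<epsilon> (Suc 0) \<omega>) + (\<epsilon> (Suc 0) \<omega>)\<^sup>2)"
      using rec[of 0] by (intro integral_cong_AE) (auto simp: algebra_simps power2_eq_square)
    also have "\<dots> = a\<^sup>2 * ?s + v" using sq e xe_int xe[of 0 0] by simp
    finally have "(1 - a\<^sup>2) * ?s = v"
      using same(1)[of "\<lambda>x. x\<^sup>2" "Suc 0"] by (simp add: algebra_simps)
    moreover have "a\<^sup>2 < 1" using a by (simp add: power_less_one_iff abs_square_less_1)
    ultimately have "?s = v / (1 - a\<^sup>2)" by (auto simp: field_simps)
    then show ?thesis using same(1)[of "\<lambda>x. x\<^sup>2" k] by (simp add: power2_eq_square)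
  qed
  have cov: "expectation (\<lambda>\<omega>. X (k + h) \<omega> * X k \<omega>) = a ^ h * v / (1 - a\<^sup>2)" for k h
  proof (induction h)
    case 0
    show ?case using var by simp
  next
    case (Suc h)
    have "expectation (\<lambda>\<omega>. X (k + Suc h) \<omega> * X k \<omega>)
      = expectation (\<lambda>\<omega>. a * (X (k + h) \<omega> * X k \<omega>) + X k \<omega> * \<epsilon> (Suc (k + h)) \<omega>)"
      using rec[of "k + h"] by (intro integral_cong_AE) (auto simp: algebra_simps)
    also have "\<dots> = a * (a ^ h * v / (1 - a\<^sup>2))" using Suc xe_int xx_int xe[of k "k + h"] by simp
    finally show ?case by simp
  qed
  show "expectation (\<lambda>\<omega>. X k \<omega> * X l \<omega>) = a ^ (k - l + (l - k)) * v / (1 - a\<^sup>2)"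
  proof (cases "l \<le> k")
    case True
    then show ?thesis using cov[of l "k - l"] by simp
  next
    case False
    then show ?thesis using cov[of k "l - k"] by (simp add: mult.commute)
  qed
qed

section \<open>Mixing over the random coefficient\<close>

text \<open>
  Integrating the conditional laws over the law of \<open>\<alpha>\<close> gives back the law of \<open>Y\<close>, which is thus a
  monadic bind.
\<close>

lemma cond_law_nn_integral:
  assumes c: "cond_law_given M \<alpha> S Y \<kappa>" and f: "f \<in> borel_measurable S"
  shows "(\<integral>\<^sup>+\<omega>. f (Y \<omega>) \<partial>M) = (\<integral>\<^sup>+a. (\<integral>\<^sup>+y. f y \<partial>\<kappa> a) \<partial>distr M borel \<alpha>)"
proof -
  let ?\<mu> = "distr M borel \<alpha>"
  have \<alpha>: "\<alpha> \<in> borel_measurable M" and Y: "Y \<in> M \<rightarrow>\<^sub>M S" and \<kappa>: "\<kappa> \<in> borel \<rightarrow>\<^sub>M prob_algebra S"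
    and all: "\<forall>A\<in>sets borel. \<forall>C\<in>sets S. emeasure M {\<omega>\<in>space M. \<alpha> \<omega> \<in> A \<and> Y \<omega> \<in> C}
      = (\<integral>\<^sup>+a\<in>A. emeasure (\<kappa> a) C \<partial>?\<mu>)"
    using c by (simp_all add: cond_law_given_def)
  have eq: "emeasure M {\<omega>\<in>space M. \<alpha> \<omega> \<in> UNIV \<and> Y \<omega> \<in> C} = (\<integral>\<^sup>+a\<in>UNIV. emeasure (\<kappa> a) C \<partial>?\<mu>)"
    if "C \<in> sets S" for C
    using all[THEN bspec, of UNIV, THEN bspec, OF _ that] by simp
  have \<kappa>': "\<kappa> \<in> ?\<mu> \<rightarrow>\<^sub>M subprob_algebra S"
    using measurable_prob_algebraD[OF \<kappa>] by simp
  have "distr M S Y = ?\<mu> \<bind> \<kappa>"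
  proof (rule measure_eqI)
    show "sets (distr M S Y) = sets (?\<mu> \<bind> \<kappa>)"
      using sets_bind[of ?\<mu> \<kappa> S] measurable_space[OF \<kappa>'] by (simp add: space_subprob_algebra)
    fix C assume "C \<in> sets (distr M S Y)"
    then have C: "C \<in> sets S" by simp
    have "emeasure (distr M S Y) C = emeasure M {\<omega>\<in>space M. \<alpha> \<omega> \<in> UNIV \<and> Y \<omega> \<in> C}"
      using Y C by (subst emeasure_distr) (auto intro!: arg_cong2[where f=emeasure])
    also have "\<dots> = emeasure (?\<mu> \<bind> \<kappa>) C"
      unfolding eq[OF C] using emeasure_bind[OF _ \<kappa>' C] by simp
    finally show "emeasure (distr M S Y) C = emeasure (?\<mu> \<bind> \<kappa>) C" .
  qed
  then have "(\<integral>\<^sup>+y. f y \<partial>distr M S Y) = (\<integral>\<^sup>+a. (\<integral>\<^sup>+y. f y \<partial>\<kappa> a) \<partial>?\<mu>)"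
    using nn_integral_bind[OF f \<kappa>'] by simp
  then show ?thesis using f by (simp add: nn_integral_distr[OF Y])
qed

lemma cond_law_integral:
  fixes f :: "'b \<Rightarrow> real"
  assumes c: "cond_law_given M \<alpha> S Y \<kappa>" and f[measurable]: "f \<in> borel_measurable S" and nonneg: "\<And>y. 0 \<le> f y"
    and g: "AE a in distr M borel \<alpha>. integrable (\<kappa> a) f \<and> (LINT y|\<kappa> a. f y) = g a"
    and gi: "integrable (distr M borel \<alpha>) g"
  shows "integrable M (\<lambda>\<omega>. f (Y \<omega>))" "(LINT \<omega>|M. f (Y \<omega>)) = (LINT a|distr M borel \<alpha>. g a)"
proof -
  have Y[measurable]: "Y \<in> M \<rightarrow>\<^sub>M S" using c by (simp add: cond_law_given_def)
  have g0: "AE a in distr M borel \<alpha>. 0 \<le> g a"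
    using g
  proof eventually_elim
    case (elim a)
    have "0 \<le> (LINT y|\<kappa> a. f y)" by (intro Bochner_Integration.integral_nonneg nonneg)
    with elim show ?case by simp
  qed
  have "(\<integral>\<^sup>+\<omega>. ennreal (f (Y \<omega>)) \<partial>M) = (\<integral>\<^sup>+a. (\<integral>\<^sup>+y. ennreal (f y) \<partial>\<kappa> a) \<partial>distr M borel \<alpha>)"
    by (rule cond_law_nn_integral[OF c]) measurable
  also have "\<dots> = (\<integral>\<^sup>+a. ennreal (g a) \<partial>distr M borel \<alpha>)"
    using g by (intro nn_integral_cong_AE, eventually_elim) (auto simp: nn_integral_eq_integral nonneg)
  also have "\<dots> = ennreal (LINT a|distr M borel \<alpha>. g a)"
    by (rule nn_integral_eq_integral[OF gi g0])
  finally have *: "(\<integral>\<^sup>+\<omega>. ennreal (f (Y \<omega>)) \<partial>M) = ennreal (LINT a|distr M borel \<alpha>. g a)" .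
  show "integrable M (\<lambda>\<omega>. f (Y \<omega>))"
    using * nonneg by (intro integrableI_nn_integral_finite[of _ _ "LINT a|distr M borel \<alpha>. g a"]) auto
  then show "(LINT \<omega>|M. f (Y \<omega>)) = (LINT a|distr M borel \<alpha>. g a)"
    using * nonneg nn_integral_eq_integral[of M "\<lambda>\<omega>. f (Y \<omega>)"] integral_nonneg_AE[OF g0]
    by (simp add: Bochner_Integration.integral_nonneg)
qed

lemma set_integrable_mult_bounded:
  fixes g b :: "real \<Rightarrow> real"
  assumes g: "set_integrable lborel S g" and b: "b \<in> borel_measurable borel"
    and C: "\<And>x. x \<in> S \<Longrightarrow> \<bar>b x\<bar> \<le> C"
  shows "set_integrable lborel S (\<lambda>x. g x * b x)"
  unfolding set_integrable_def
proof (rule Bochner_Integration.integrable_bound)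
  show "integrable lborel (\<lambda>x. C * (indicator S x *\<^sub>R g x))"
    using g by (simp add: set_integrable_def)
  have "(\<lambda>x. (indicator S x *\<^sub>R g x) * b x) \<in> borel_measurable lborel"
    using g b by (auto simp: set_integrable_def intro!: borel_measurable_times borel_measurable_integrable)
  then show "(\<lambda>x. indicator S x *\<^sub>R (g x * b x)) \<in> borel_measurable lborel" by (simp add: mult.assoc)
  show "AE x in lborel. norm (indicator S x *\<^sub>R (g x * b x)) \<le> norm (C * (indicator S x *\<^sub>R g x))"
  proof (rule AE_I2)
    fix x
    have "\<bar>g x\<bar> * \<bar>b x\<bar> \<le> \<bar>g x\<bar> * \<bar>C\<bar>" if "x \<in> S" using C[OF that] by (intro mult_left_mono) auto
    then show "norm (indicator S x *\<^sub>R (g x * b x)) \<le> norm (C * (indicator S x *\<^sub>R g x))"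
      by (auto simp: abs_mult mult.commute split: split_indicator)
  qed
qed

text \<open>
  The factor \<open>1 - x\<close> of the density cancels against \<open>1 - x\<^sup>2 = (1 - x) (1 + x)\<close>. This is why
  integrability of \<open>\<psi>\<close> suffices for finite second moments.
\<close>

lemma mixing_density_integral:
  fixes \<psi> b :: "real \<Rightarrow> real" and \<alpha> :: "'b \<Rightarrow> real"
  assumes d: "distributed M lborel \<alpha> (\<lambda>x. ennreal (indicator {0..<1} x * (\<psi> x * (1 - x) powr 1)))"
    and pos: "AE x in lborel. x \<in> {0..<1} \<longrightarrow> 0 \<le> \<psi> x"
    and \<psi>: "set_integrable lborel {0..<1} \<psi>"
    and b[measurable]: "b \<in> borel_measurable borel" and b1: "\<And>x. 0 \<le> x \<Longrightarrow> x < 1 \<Longrightarrow> \<bar>b x\<bar> \<le> 1"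
  shows "set_integrable lborel {0..<1} (\<lambda>x. \<psi> x / (1 + x) * b x)"
    "integrable (distr M borel \<alpha>) (\<lambda>a. b a / (1 - a\<^sup>2))"
    "(LINT a|distr M borel \<alpha>. b a / (1 - a\<^sup>2)) = (LINT x:{0..<1}|lborel. \<psi> x / (1 + x) * b x)"
proof -
  define f where "f x = indicator {0..<1} x * (\<psi> x * (1 - x) powr 1)" for x :: real
  have \<psi>i: "integrable lborel (\<lambda>x. indicator {0..<1} x * \<psi> x)"
    using \<psi> by (simp add: set_integrable_def)
  then have [measurable]: "(\<lambda>x. indicator {0..<1} x * \<psi> x) \<in> borel_measurable borel"
    using borel_measurable_integrable by fastforce
  have f_eq: "f = (\<lambda>x. (indicator {0..<1} x * \<psi> x) * (1 - x))"
    by (auto simp: f_def fun_eq_iff split: split_indicator)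
  have [measurable]: "f \<in> borel_measurable borel" unfolding f_eq by measurable
  have \<alpha>[measurable]: "\<alpha> \<in> borel_measurable M" using d by (simp add: distributed_def)
  have d': "distributed M lborel \<alpha> (\<lambda>x. ennreal (max 0 (f x)))"
  proof -
    have "ennreal (max 0 y) = ennreal y" for y by (simp add: max_def ennreal_neg)
    then show ?thesis using d unfolding f_def[symmetric] by simp
  qed
  have ae: "AE x in lborel. max 0 (f x) * (b x / (1 - x\<^sup>2)) = indicator {0..<1} x *\<^sub>R (\<psi> x / (1 + x) * b x)"
    using pos
  proof eventually_elim
    case (elim x)
    show ?case
    proof (cases "x \<in> {0..<1}")
      case True
      then have fx: "f x = \<psi> x * (1 - x)" and "1 - x \<noteq> 0" by (auto simp: f_def)
      moreover have "0 \<le> f x" unfolding fx using elim True by (intro mult_nonneg_nonneg) auto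
      moreover have "1 - x\<^sup>2 = (1 - x) * (1 + x)" by (simp add: power2_eq_square algebra_simps)
      ultimately show ?thesis using True by (simp add: max_def)
    qed (simp add: f_def)
  qed
  have bound: "\<bar>b x / (1 + x)\<bar> \<le> 1" if "x \<in> {0..<1}" for x
    using b1[of x] that by (simp add: abs_divide divide_le_eq_1)
  have "set_integrable lborel {0..<1} (\<lambda>x. \<psi> x * (b x / (1 + x)))"
    by (rule set_integrable_mult_bounded[OF \<psi> _ bound]) measurable
  then have i': "integrable lborel (\<lambda>x. indicator {0..<1} x *\<^sub>R (\<psi> x / (1 + x) * b x))"
    by (simp add: set_integrable_def)
  then show "set_integrable lborel {0..<1} (\<lambda>x. \<psi> x / (1 + x) * b x)"
    by (simp add: set_integrable_def)
  have "integrable lborel (\<lambda>x. max 0 (f x) * (b x / (1 - x\<^sup>2)))"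
    by (subst integrable_cong_AE[OF _ _ ae]) (use i' in \<open>auto intro: borel_measurable_integrable\<close>)
  then show "integrable (distr M borel \<alpha>) (\<lambda>a. b a / (1 - a\<^sup>2))"
    by (subst integrable_distr_eq) (auto simp: distributed_integrable[OF d', of "\<lambda>a. b a / (1 - a\<^sup>2)", symmetric])
  have "(LINT a|distr M borel \<alpha>. b a / (1 - a\<^sup>2)) = (LINT x|lborel. max 0 (f x) * (b x / (1 - x\<^sup>2)))"
    by (subst integral_distr) (auto simp: distributed_integral[OF d', of "\<lambda>a. b a / (1 - a\<^sup>2)", symmetric])
  also have "\<dots> = (LINT x|lborel. indicator {0..<1} x *\<^sub>R (\<psi> x / (1 + x) * b x))"
    by (rule integral_cong_AE[OF _ _ ae]) (use i' in \<open>auto intro: borel_measurable_integrable\<close>)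
  finally show "(LINT a|distr M borel \<alpha>. b a / (1 - a\<^sup>2)) = (LINT x:{0..<1}|lborel. \<psi> x / (1 + x) * b x)"
    by (simp add: set_lebesgue_integral_def)
qed

text \<open>
  The expectation of \<open>\<alpha>\<^sup>h / (1 - \<alpha>\<^sup>2)\<close> for \<open>\<alpha>\<close> with the density \<open>\<psi> x (1 - x)\<close>.
\<close>

definition mixed_moment :: "(real \<Rightarrow> real) \<Rightarrow> nat \<Rightarrow> real" where
  "mixed_moment \<psi> h = (LINT x:{0..<1}|lborel. \<psi> x / (1 + x) * x ^ h)"

text \<open>
  The conditional moments are averaged over \<open>\<alpha>\<close>. Squares of affine functions of \<open>X k\<close> and \<open>X l\<close> are
  nonnegative, so they can be integrated conditionally without knowing integrability beforehand;
  mean and covariance then follow by polarisation.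
\<close>

lemma randomized_ar1_moments:
  fixes \<alpha> :: "'b \<Rightarrow> real"
  assumes v: "0 \<le> v" and \<alpha>1: "\<forall>\<omega>\<in>space M. \<alpha> \<omega> \<in> {0..<1}"
    and d: "distributed M lborel \<alpha> (\<lambda>x. ennreal (indicator {0..<1} x * (\<psi> x * (1 - x) powr 1)))"
    and pos: "AE x in lborel. x \<in> {0..<1} \<longrightarrow> 0 \<le> \<psi> x"
    and \<psi>: "set_integrable lborel {0..<1} \<psi>"
    and ar: "randomized_ar1 M v \<alpha> X"
  shows "X k \<in> borel_measurable M" "integrable M (\<lambda>\<omega>. (X k \<omega>)\<^sup>2)" "(LINT \<omega>|M. X k \<omega>) = 0"
    "(LINT \<omega>|M. X k \<omega> * X l \<omega>) = v * mixed_moment \<psi> (k - l + (l - k))"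
proof -
  obtain \<epsilon> \<kappa> where M: "prob_space M" and c: "cond_law_given M \<alpha> (seq0_space \<Otimes>\<^sub>M seq1_space)
          (\<lambda>\<omega>. (\<lambda>k. X k \<omega>, \<lambda>k\<in>{1..}. \<epsilon> k \<omega>)) \<kappa>"
    and st: "AE a in distr M borel \<alpha>. stationary_ar1 (\<kappa> a) a v (\<lambda>k w. fst w k) (\<lambda>k w. snd w k)"
    using ar unfolding randomized_ar1_def by blast
  interpret prob_space M by fact
  let ?S = "seq0_space \<Otimes>\<^sub>M seq1_space" and ?\<mu> = "distr M borel \<alpha>"
  have \<alpha>[measurable]: "\<alpha> \<in> borel_measurable M" using d by (simp add: distributed_def)
  interpret \<mu>: prob_space ?\<mu> by (rule prob_space_distr) simp
  have Y: "(\<lambda>\<omega>. (\<lambda>k. X k \<omega>, \<lambda>k\<in>{1..}. \<epsilon> k \<omega>)) \<in> M \<rightarrow>\<^sub>M ?S" using c by (simp add: cond_law_given_def)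
  have coord: "(\<lambda>w. fst w k) \<in> borel_measurable ?S" for k :: nat
    by measurable
  show X[measurable]: "X k \<in> borel_measurable M" for k
    using measurable_compose[OF Y coord[of k]] by simp
  have range: "AE a in ?\<mu>. 0 \<le> a \<and> a < 1"
    by (subst AE_distr_iff) (use \<alpha>1 in auto)
  define s where "s h a = a ^ h / (1 - a\<^sup>2)" for h and a :: real
  have s_int: "integrable ?\<mu> (s h)" "(LINT a|?\<mu>. s h a) = mixed_moment \<psi> h" for h
    using mixing_density_integral(2,3)[OF d pos \<psi>, of "\<lambda>x. x ^ h"]
    by (auto simp: power_le_one mixed_moment_def s_def[abs_def] power_abs)
  have moments: "AE a in ?\<mu>. prob_space (\<kappa> a) \<and> sets (\<kappa> a) = sets ?S \<and> (\<forall>k. integrable (\<kappa> a) (\<lambda>w. (fst w k)\<^sup>2))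
     \<and> (\<forall>k. (LINT w|\<kappa> a. fst w k) = 0) \<and> (\<forall>k l. (LINT w|\<kappa> a. fst w k * fst w l) = v * s (k - l + (l - k)) a)"
    using st range
  proof eventually_elim
    case (elim a)
    have "\<kappa> a \<in> space (prob_algebra ?S)"
      using c measurable_space[of \<kappa> borel "prob_algebra ?S" a] by (simp add: cond_law_given_def)
    then show ?case
      using stationary_ar1_moments[OF elim(1) _ _ v] elim(2)
      by (auto simp: space_prob_algebra s_def ac_simps)
  qed
  have quad: "integrable M (\<lambda>\<omega>. (p * X k \<omega> + q * X l \<omega> + r)\<^sup>2)
    \<and> (LINT \<omega>|M. (p * X k \<omega> + q * X l \<omega> + r)\<^sup>2)
      = v * ((p\<^sup>2 + q\<^sup>2) * mixed_moment \<psi> 0 + 2 * p * q * mixed_moment \<psi> (k - l + (l - k))) + r\<^sup>2" for p q r k l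
  proof -
    let ?g = "\<lambda>a. v * ((p\<^sup>2 + q\<^sup>2) * s 0 a + 2 * p * q * s (k - l + (l - k)) a) + r\<^sup>2"
    have "AE a in ?\<mu>. integrable (\<kappa> a) (\<lambda>w. (p * fst w k + q * fst w l + r)\<^sup>2)
      \<and> (LINT w|\<kappa> a. (p * fst w k + q * fst w l + r)\<^sup>2) = ?g a"
      using moments
    proof eventually_elim
      case (elim a)
      interpret K: prob_space "\<kappa> a" using elim by simp
      have [measurable]: "(\<lambda>w. fst w k) \<in> borel_measurable (\<kappa> a)" for k
        using coord[of k] elim by (simp cong: measurable_cong_sets)
      have i2: "integrable (\<kappa> a) (\<lambda>w. (fst w k)\<^sup>2)" for k using elim by simp
      have ii: "integrable (\<kappa> a) (\<lambda>w. fst w k * fst w l)" for k l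
        by (intro integrable_mult_square i2) auto
      have i1: "integrable (\<kappa> a) (\<lambda>w. fst w k)" for k
        by (rule K.square_integrable_imp_integrable[OF _ i2]) simp
      have m: "(LINT w|\<kappa> a. fst w k) = 0" "(LINT w|\<kappa> a. fst w k * fst w l) = v * s (k - l + (l - k)) a" for k l
        using elim by simp_all
      have eq: "(\<lambda>w. (p * fst w k + q * fst w l + r)\<^sup>2) = (\<lambda>w. p\<^sup>2 * (fst w k * fst w k) + q\<^sup>2 * (fst w l * fst w l)
          + 2 * p * q * (fst w k * fst w l) + 2 * p * r * fst w k + 2 * q * r * fst w l + r\<^sup>2)"
        by (simp add: power2_eq_square algebra_simps)
      have "(LINT w|\<kappa> a. (p * fst w k + q * fst w l + r)\<^sup>2)
        = p\<^sup>2 * (v * s 0 a) + q\<^sup>2 * (v * s 0 a) + 2 * p * q * (v * s (k - l + (l - k)) a) + r\<^sup>2"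
        unfolding eq by (simp add: ii i1 m K.prob_space)
      moreover have "integrable (\<kappa> a) (\<lambda>w. (p * fst w k + q * fst w l + r)\<^sup>2)"
        unfolding eq by (intro Bochner_Integration.integrable_add integrable_mult_right ii i1) simp
      ultimately show ?case by (simp add: algebra_simps)
    qed
    moreover have "integrable ?\<mu> ?g" using s_int by simp
    moreover have "(LINT a|?\<mu>. ?g a) = v * ((p\<^sup>2 + q\<^sup>2) * mixed_moment \<psi> 0 + 2 * p * q * mixed_moment \<psi> (k - l + (l - k))) + r\<^sup>2"
      using s_int \<mu>.prob_space by simp
    ultimately show ?thesis
      using cond_law_integral[OF c, of "\<lambda>w. (p * fst w k + q * fst w l + r)\<^sup>2" ?g] coord by simp
  qed
  show sq: "integrable M (\<lambda>\<omega>. (X k \<omega>)\<^sup>2)" for k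
    using quad[of 1 k 0 0 0] by simp
  have i1: "integrable M (X k)" for k
    by (rule square_integrable_imp_integrable[OF _ sq]) simp
  have ii: "integrable M (\<lambda>\<omega>. X k \<omega> * X l \<omega>)" for k l
    by (intro integrable_mult_square sq) auto
  have "(LINT \<omega>|M. (X k \<omega> + 1)\<^sup>2) = (LINT \<omega>|M. (X k \<omega>)\<^sup>2) + 2 * (LINT \<omega>|M. X k \<omega>) + 1"
    using sq i1 by (simp add: power2_sum prob_space)
  then show "(LINT \<omega>|M. X k \<omega>) = 0"
    using quad[of 1 k 0 0 1] quad[of 1 k 0 0 0] by simp
  have "(LINT \<omega>|M. (X k \<omega> + X l \<omega>)\<^sup>2) = (LINT \<omega>|M. (X k \<omega>)\<^sup>2) + (LINT \<omega>|M. (X l \<omega>)\<^sup>2) + 2 * (LINT \<omega>|M. X k \<omega> * X l \<omega>)"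
    using sq ii by (simp add: power2_sum mult.assoc)
  then show "(LINT \<omega>|M. X k \<omega> * X l \<omega>) = v * mixed_moment \<psi> (k - l + (l - k))"
    using quad[of 1 k 0 k 0] quad[of 1 l 0 l 0] quad[of 1 k 1 l 0] by (simp add: algebra_simps)
qed

section \<open>The central limit theorem for the copies\<close>

text \<open>
  Normalising by \<open>N\<^sup>-\<^sup>1\<^sup>/\<^sup>2\<close> and evaluating the characteristic function at \<open>1\<close>, instead of dividing by
  the standard deviation, lets the statement include the degenerate variance \<open>0\<close>.
\<close>

lemma (in prob_space) clt_iexp:
  assumes ind: "indep_vars (\<lambda>_. borel) U {1..}"
    and D: "\<And>j. 1 \<le> j \<Longrightarrow> distr M borel (U j) = D"
    and sq: "integrable D (\<lambda>x. x\<^sup>2)" and mean: "(LINT x|D. x) = 0" and var: "(LINT x|D. x\<^sup>2) = \<tau>"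
  shows "(\<lambda>N. CLINT \<omega>|M. iexp (real N powr (- 1 / 2) * (\<Sum>j=1..N. U j \<omega>))) \<longlonglongrightarrow> of_real (exp (- \<tau> / 2))"
proof -
  have U[measurable]: "U (Suc n) \<in> borel_measurable M" for n
    using ind by (simp add: indep_vars_def)
  have sq': "integrable M (\<lambda>\<omega>. (U (Suc n) \<omega>)\<^sup>2)" for n
    using sq by (subst (asm) D[of "Suc n", symmetric]) (simp_all add: integrable_distr_eq)
  have mean': "expectation (U (Suc n)) = 0" for n
    using mean by (subst (asm) D[of "Suc n", symmetric]) (simp_all add: integral_distr)
  have var': "expectation (\<lambda>\<omega>. (U (Suc n) \<omega>)\<^sup>2) = \<tau>" for n
    using var by (subst (asm) D[of "Suc n", symmetric]) (simp_all add: integral_distr)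
  have \<tau>0: "0 \<le> \<tau>" using var'[of 0] Bochner_Integration.integral_nonneg[of M "\<lambda>\<omega>. (U (Suc 0) \<omega>)\<^sup>2"] by simp
  have shift: "(\<Sum>j=1..N. U j \<omega>) = (\<Sum>i<N. U (Suc i) \<omega>)" for N \<omega>
    by (simp add: sum.atLeast1_atMost_eq)
  show ?thesis
  proof (cases "\<tau> = 0")
    case True
    have "AE \<omega> in M. U (Suc n) \<omega> = 0" for n
      using integral_nonneg_eq_0_iff_AE[OF sq'[of n]] var'[of n] True by simp
    then have zero: "AE \<omega> in M. \<forall>n. U (Suc n) \<omega> = 0" by (simp add: AE_all_countable)
    have "(CLINT \<omega>|M. iexp (real N powr (- 1 / 2) * (\<Sum>j=1..N. U j \<omega>))) = (CLINT \<omega>|M. 1)" for N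
      unfolding shift using zero by (intro integral_cong_AE) auto
    then show ?thesis using True by (simp add: prob_space)
  next
    case False
    define \<sigma> where "\<sigma> = sqrt \<tau>"
    have \<sigma>: "0 < \<sigma>" "\<sigma>\<^sup>2 = \<tau>" using False \<tau>0 by (auto simp: \<sigma>_def)
    define S where "S N \<omega> = (\<Sum>i<N. U (Suc i) \<omega>)" for N \<omega>
    have wc: "weak_conv_m (\<lambda>N. distr M borel (\<lambda>\<omega>. S N \<omega> / sqrt (real N * \<sigma>\<^sup>2))) std_normal_distribution"
      unfolding S_def
    proof (rule central_limit_theorem_zero_mean[where \<mu> = D])
      show "indep_vars (\<lambda>_. borel) (\<lambda>n. U (Suc n)) UNIV"
        using indep_vars_inj_reindex[OF ind, of Suc UNIV] by auto
    qed (use sq' mean' var' \<sigma> D in auto)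
    have "(\<lambda>N. char (distr M borel (\<lambda>\<omega>. S N \<omega> / sqrt (real N * \<sigma>\<^sup>2))) \<sigma>) \<longlonglongrightarrow> char std_normal_distribution \<sigma>"
      by (intro levy_continuity1[OF _ _ wc] real_distribution_distr real_dist_normal_dist) (simp add: S_def)
    also have "(\<lambda>N. char (distr M borel (\<lambda>\<omega>. S N \<omega> / sqrt (real N * \<sigma>\<^sup>2))) \<sigma>)
       = (\<lambda>N. CLINT \<omega>|M. iexp (real N powr (- 1 / 2) * (\<Sum>j=1..N. U j \<omega>)))"
    proof
      fix N
      have "\<sigma> * (x / sqrt (real N * \<sigma>\<^sup>2)) = real N powr (- 1 / 2) * x" for x
        using \<sigma>(1) by (cases "N = 0") (simp_all add: real_sqrt_mult powr_minus powr_half_sqrt field_simps)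
      then show "char (distr M borel (\<lambda>\<omega>. S N \<omega> / sqrt (real N * \<sigma>\<^sup>2))) \<sigma>
        = (CLINT \<omega>|M. iexp (real N powr (- 1 / 2) * (\<Sum>j=1..N. U j \<omega>)))"
        unfolding char_def shift S_def by (subst integral_distr) auto
    qed
    finally show ?thesis by (simp add: char_std_normal_distribution \<sigma>)
  qed
qed

lemma independent_copies_iexp:
  assumes c: "independent_copies M \<alpha>j Xj M0 \<alpha> X" and M0: "prob_space M0"
    and \<alpha>: "\<alpha> \<in> borel_measurable M0" and X: "\<And>k. X k \<in> borel_measurable M0"
    and sq: "\<And>k. integrable M0 (\<lambda>\<omega>. (X k \<omega>)\<^sup>2)" and mean: "\<And>k. (LINT \<omega>|M0. X k \<omega>) = 0"
  shows "(\<lambda>N. CLINT \<omega>|M. iexp (real N powr (- 1 / 2) * (\<Sum>j=1..N. \<Sum>k<m. w k * Xj j k \<omega>)))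
    \<longlonglongrightarrow> of_real (exp (- (\<Sum>k<m. \<Sum>l<m. w k * w l * (LINT \<omega>|M0. X k \<omega> * X l \<omega>)) / 2))"
proof -
  interpret M: prob_space M using c by (simp add: independent_copies_def)
  interpret M0: prob_space M0 by fact
  let ?S = "borel \<Otimes>\<^sub>M seq0_space :: (real \<times> (nat \<Rightarrow> real)) measure"
  have ind: "M.indep_vars (\<lambda>_. ?S) (\<lambda>j \<omega>. (\<alpha>j j \<omega>, \<lambda>k. Xj j k \<omega>)) {1..}"
    and same: "\<And>j. 1 \<le> j \<Longrightarrow> distr M ?S (\<lambda>\<omega>. (\<alpha>j j \<omega>, \<lambda>k. Xj j k \<omega>)) = distr M0 ?S (\<lambda>\<omega>. (\<alpha> \<omega>, \<lambda>k. X k \<omega>))"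
    using c by (simp_all add: independent_copies_def)
  define g where "g y = (\<Sum>k<m. w k * snd y k)" for y :: "real \<times> (nat \<Rightarrow> real)"
  have g[measurable]: "g \<in> borel_measurable ?S" unfolding g_def by measurable
  have rv: "(\<lambda>\<omega>. (\<alpha>j j \<omega>, \<lambda>k. Xj j k \<omega>)) \<in> M \<rightarrow>\<^sub>M ?S" if "1 \<le> j" for j
    using ind that by (auto simp: M.indep_vars_def)
  have rv0: "(\<lambda>\<omega>. (\<alpha> \<omega>, \<lambda>k. X k \<omega>)) \<in> M0 \<rightarrow>\<^sub>M ?S"
    using \<alpha> X by (auto intro!: measurable_Pair measurable_PiM_single')
  define D where "D = distr M0 borel (\<lambda>\<omega>. g (\<alpha> \<omega>, \<lambda>k. X k \<omega>))"
  have gX: "(\<lambda>\<omega>. g (\<alpha> \<omega>, \<lambda>k. X k \<omega>)) \<in> borel_measurable M0"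
    using measurable_compose[OF rv0 g] by simp
  have xx: "integrable M0 (\<lambda>\<omega>. X k \<omega> * X l \<omega>)" for k l
    by (intro integrable_mult_square X sq)
  have x: "integrable M0 (X k)" for k
    by (rule M0.square_integrable_imp_integrable[OF X sq])
  have g2: "(g (\<alpha> \<omega>, \<lambda>k. X k \<omega>))\<^sup>2 = (\<Sum>k<m. \<Sum>l<m. w k * w l * (X k \<omega> * X l \<omega>))" for \<omega>
    by (simp add: g_def power2_eq_square sum_product ac_simps)
  have "(\<lambda>N. CLINT \<omega>|M. iexp (real N powr (- 1 / 2) * (\<Sum>j=1..N. g (\<alpha>j j \<omega>, \<lambda>k. Xj j k \<omega>))))
    \<longlonglongrightarrow> of_real (exp (- (\<Sum>k<m. \<Sum>l<m. w k * w l * (LINT \<omega>|M0. X k \<omega> * X l \<omega>)) / 2))"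
  proof (rule M.clt_iexp[where D = D])
    show "M.indep_vars (\<lambda>_. borel) (\<lambda>j \<omega>. g (\<alpha>j j \<omega>, \<lambda>k. Xj j k \<omega>)) {1..}"
      by (rule M.indep_vars_compose2[OF ind]) simp
    fix j :: nat assume j: "1 \<le> j"
    have "distr M borel (\<lambda>\<omega>. g (\<alpha>j j \<omega>, \<lambda>k. Xj j k \<omega>)) = distr (distr M ?S (\<lambda>\<omega>. (\<alpha>j j \<omega>, \<lambda>k. Xj j k \<omega>))) borel g"
      using rv[OF j] by (simp add: distr_distr comp_def)
    also have "\<dots> = D"
      unfolding same[OF j] D_def using rv0 by (simp add: distr_distr comp_def)
    finally show "distr M borel (\<lambda>\<omega>. g (\<alpha>j j \<omega>, \<lambda>k. Xj j k \<omega>)) = D" .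
  next
    show "integrable D (\<lambda>x. x\<^sup>2)"
      unfolding D_def using gX xx by (simp add: integrable_distr_eq g2)
    show "(LINT x|D. x) = 0"
      unfolding D_def using gX x mean by (simp add: integral_distr) (simp add: g_def)
    show "(LINT x|D. x\<^sup>2) = (\<Sum>k<m. \<Sum>l<m. w k * w l * (LINT \<omega>|M0. X k \<omega> * X l \<omega>))"
      unfolding D_def using gX xx by (simp add: integral_distr g2)
  qed
  then show ?thesis by (simp add: g_def)
qed

section \<open>Growth of the variance of partial sums\<close>

text \<open>
  The sum of all entries of the symmetric Toeplitz matrix \<open>r \<bar>k - l\<bar>\<close> of size \<open>m\<close>; for a stationary
  sequence with autocovariance \<open>r\<close> it is the variance of the sum of \<open>m\<close> consecutive terms.
\<close>

definition toeplitz_sum :: "(nat \<Rightarrow> real) \<Rightarrow> nat \<Rightarrow> real" where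
  "toeplitz_sum r m = (\<Sum>k=1..m. \<Sum>l=1..m. r (k - l + (l - k)))"

lemma toeplitz_sum_Suc: "toeplitz_sum r (Suc m) = toeplitz_sum r m + 2 * (\<Sum>i=1..m. r i) + r 0"
proof -
  have rev: "(\<Sum>k=1..m. r (Suc m - k)) = (\<Sum>i=1..m. r i)"
    by (rule sum.reindex_bij_witness[of _ "\<lambda>i. Suc m - i" "\<lambda>i. Suc m - i"]) auto
  have "toeplitz_sum r (Suc m) = toeplitz_sum r m + (\<Sum>k=1..m. r (k - Suc m + (Suc m - k)))
      + (\<Sum>l=1..m. r (Suc m - l + (l - Suc m))) + r 0"
    unfolding toeplitz_sum_def by (simp add: sum.distrib)
  also have "(\<Sum>k=1..m. r (k - Suc m + (Suc m - k))) = (\<Sum>i=1..m. r i)"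
    unfolding rev[symmetric] by (intro sum.cong) auto
  also have "(\<Sum>l=1..m. r (Suc m - l + (l - Suc m))) = (\<Sum>i=1..m. r i)"
    unfolding rev[symmetric] by (intro sum.cong) auto
  finally show ?thesis by simp
qed

text \<open>
  For a stationary sequence with partial sums \<open>S\<close> this is
  \<open>E (S\<^sub>p S\<^sub>q) = (E S\<^sub>p\<^sup>2 + E S\<^sub>q\<^sup>2 - E (S\<^sub>q - S\<^sub>p)\<^sup>2) / 2\<close>, where \<open>S\<^sub>q - S\<^sub>p\<close> has the variance of \<open>S\<^bsub>q-p\<^esub>\<close>.
\<close>

lemma toeplitz_rectangle:
  assumes "p \<le> q"
  shows "(\<Sum>k=1..p. \<Sum>l=1..q. r (k - l + (l - k))) = (toeplitz_sum r p + toeplitz_sum r q - toeplitz_sum r (q - p)) / 2"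
proof -
  let ?f = "\<lambda>k l. r (k - l + (l - k)) :: real" and ?A = "{1..p}" and ?B = "{Suc p..q}"
  have split: "{1..q} = ?A \<union> ?B" using assms by auto
  have split_sum: "(\<Sum>k=1..q. F k) = (\<Sum>k\<in>?A. F k) + (\<Sum>k\<in>?B. F k)" for F :: "nat \<Rightarrow> real"
    unfolding split by (rule sum.union_disjoint) auto
  have off: "(\<Sum>k\<in>?B. \<Sum>l\<in>?A. ?f k l) = (\<Sum>k\<in>?A. \<Sum>l\<in>?B. ?f k l)"
    by (subst sum.swap) (simp add: add.commute)
  have shift: "(\<Sum>k\<in>?B. F k) = (\<Sum>k=1..q - p. F (k + p))" for F :: "nat \<Rightarrow> real"
    using sum.shift_bounds_cl_nat_ivl[of F 1 p "q - p"] assms by simp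
  have "(\<Sum>k\<in>?B. \<Sum>l\<in>?B. ?f k l) = toeplitz_sum r (q - p)"
    unfolding shift toeplitz_sum_def by simp
  moreover have "toeplitz_sum r q = (\<Sum>k\<in>?A. \<Sum>l\<in>?A. ?f k l) + (\<Sum>k\<in>?A. \<Sum>l\<in>?B. ?f k l)
      + ((\<Sum>k\<in>?B. \<Sum>l\<in>?A. ?f k l) + (\<Sum>k\<in>?B. \<Sum>l\<in>?B. ?f k l))"
    unfolding toeplitz_sum_def split_sum sum.distrib by (simp only: ac_simps)
  ultimately have "toeplitz_sum r q = toeplitz_sum r p + 2 * (\<Sum>k\<in>?A. \<Sum>l\<in>?B. ?f k l) + toeplitz_sum r (q - p)"
    unfolding off by (simp only: toeplitz_sum_def)
  moreover have "(\<Sum>k\<in>?A. \<Sum>l=1..q. ?f k l) = toeplitz_sum r p + (\<Sum>k\<in>?A. \<Sum>l\<in>?B. ?f k l)"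
    unfolding toeplitz_sum_def split_sum sum.distrib by (rule refl)
  ultimately show ?thesis by simp
qed

text \<open>
  As \<open>x\<^sup>h\<close> has the integral \<open>1 / (h + 1)\<close>, this is the total mass of the kernel \<open>T\<^sub>m\<close>. It is the source
  of the logarithm in the normalisation.
\<close>

lemma toeplitz_sum_inverse: "toeplitz_sum (\<lambda>h. 1 / (real h + 1)) m = 2 * (real m + 1) * harm m - 3 * real m"
proof (induction m)
  case 0
  show ?case by (simp add: toeplitz_sum_def harm_def)
next
  case (Suc m)
  have "harm (Suc m) = 1 + (\<Sum>i=1..m. 1 / (real i + 1))"
  proof (induction m)
    case (Suc m)
    then show ?case by (simp add: harm_Suc[of "Suc m"] inverse_eq_divide add.commute)
  qed (simp add: harm_def)
  then have *: "(\<Sum>i=1..m. 1 / (real i + 1)) = harm (Suc m) - 1" by simp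
  have "harm m = harm (Suc m) - 1 / (real m + 1)"
    by (simp add: harm_Suc inverse_eq_divide add.commute)
  then show ?case unfolding toeplitz_sum_Suc * Suc by (simp add: field_simps)
qed

lemma toeplitz_sum_power_bounds:
  assumes "0 \<le> x" "x < 1"
  shows "0 \<le> toeplitz_sum (\<lambda>h. x ^ h) m" "toeplitz_sum (\<lambda>h. x ^ h) m \<le> real m * real m"
    "toeplitz_sum (\<lambda>h. x ^ h) m \<le> 2 * real m / (1 - x)"
proof -
  show "0 \<le> toeplitz_sum (\<lambda>h. x ^ h) m"
    unfolding toeplitz_sum_def using assms by (intro sum_nonneg) auto
  have "toeplitz_sum (\<lambda>h. x ^ h) m \<le> (\<Sum>k=1..m. \<Sum>l=1..m. 1)"
    unfolding toeplitz_sum_def using assms by (intro sum_mono) (auto intro: power_le_one)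
  then show "toeplitz_sum (\<lambda>h. x ^ h) m \<le> real m * real m" by simp
  show "toeplitz_sum (\<lambda>h. x ^ h) m \<le> 2 * real m / (1 - x)"
  proof (induction m)
    case (Suc m)
    have "1 + (\<Sum>i=1..m. x ^ i) = (\<Sum>i<Suc m. x ^ i)"
      by (simp only: sum.lessThan_Suc_shift One_nat_def sum.atLeast1_atMost_eq power_0)
    also have "\<dots> \<le> (\<Sum>i. x ^ i)"
      using assms by (intro sum_le_suminf summable_geometric) auto
    also have "\<dots> = 1 / (1 - x)" using assms by (intro suminf_geometric) auto
    finally have "2 * (\<Sum>i=1..m. x ^ i) + 1 \<le> 2 * (1 / (1 - x))" by simp
    with Suc show ?case unfolding toeplitz_sum_Suc by (simp add: field_simps add_divide_distrib)
  qed (simp add: toeplitz_sum_def)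
qed

lemma harm_over_ln: "(\<lambda>m. harm m / ln (real m)) \<longlonglongrightarrow> 1"
proof -
  have l: "(\<lambda>m. 1 / ln (real m)) \<longlonglongrightarrow> 0"
    by (intro tendsto_divide_0[OF tendsto_const] filterlim_at_top_imp_at_infinity
        filterlim_compose[OF ln_at_top filterlim_real_sequentially])
  have "(\<lambda>m. (harm m - ln (real m)) * (1 / ln (real m)) + 1) \<longlonglongrightarrow> euler_mascheroni * 0 + 1"
    by (intro tendsto_intros l euler_mascheroni_LIMSEQ)
  moreover have "\<forall>\<^sub>F m in sequentially. (harm m - ln (real m)) * (1 / ln (real m)) + 1 = harm m / ln (real m)"
    using eventually_gt_at_top[of 1] by eventually_elim (simp add: field_simps)
  ultimately show ?thesis by (auto dest: Lim_transform_eventually)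
qed

lemma toeplitz_sum_inverse_asymp:
  "(\<lambda>m. toeplitz_sum (\<lambda>h. 1 / (real h + 1)) m / (real m * ln (real m))) \<longlonglongrightarrow> 2"
proof -
  have l: "(\<lambda>m. 1 / ln (real m)) \<longlonglongrightarrow> 0"
    by (intro tendsto_divide_0[OF tendsto_const] filterlim_at_top_imp_at_infinity
        filterlim_compose[OF ln_at_top filterlim_real_sequentially])
  have "(\<lambda>m. 2 * (1 + 1 / real m) * (harm m / ln (real m)) - 3 * (1 / ln (real m))) \<longlonglongrightarrow> 2 * (1 + 0) * 1 - 3 * 0"
    by (intro tendsto_intros l harm_over_ln lim_1_over_n)
  moreover have "\<forall>\<^sub>F m in sequentially. 2 * (1 + 1 / real m) * (harm m / ln (real m)) - 3 * (1 / ln (real m))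
      = toeplitz_sum (\<lambda>h. 1 / (real h + 1)) m / (real m * ln (real m))"
    unfolding toeplitz_sum_inverse using eventually_gt_at_top[of 1] by eventually_elim (simp add: field_simps)
  ultimately show ?thesis by (auto dest: Lim_transform_eventually)
qed

lemma integral_power_01: "(LINT x:{0..<1}|lborel. x ^ h) = 1 / (real h + 1)"
proof -
  have "(LINT x:{0..<1}|lborel. x ^ h) = (LINT x|lborel. x ^ h * indicator {0..1::real} x)"
    unfolding set_lebesgue_integral_def
    by (intro integral_cong_AE) (auto intro!: AE_I'[of "{1}"] split: split_indicator)
  then show ?thesis by (simp add: integral_power add.commute)
qed

text \<open>
  The kernels \<open>h m / (m log m)\<close> have masses tending to \<open>2\<close> and concentrate at \<open>1\<close>. Near \<open>1\<close> the
  deviation \<open>D\<close> of \<open>\<psi> x / (1 + x)\<close> from its limit is small; on \<open>[0, \<delta>]\<close> the kernel is at most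
  \<open>2 m / (1 - \<delta>)\<close>, which is negligible against \<open>m log m\<close>.
\<close>

lemma toeplitz_mixed_moment_asymp:
  fixes \<psi> :: "real \<Rightarrow> real"
  assumes \<psi>: "set_integrable lborel {0..<1} \<psi>" and lim: "(\<psi> \<longlongrightarrow> \<psi>1) (at_left 1)"
  shows "(\<lambda>m. toeplitz_sum (mixed_moment \<psi>) m / (real m * ln (real m))) \<longlonglongrightarrow> \<psi>1"
proof -
  define g where "g x = \<psi> x / (1 + x)" for x
  define D where "D x = g x - \<psi>1 / 2" for x
  define h where "h m x = toeplitz_sum (\<lambda>i. x ^ i) m" for m and x :: real
  define A where "A m = toeplitz_sum (\<lambda>h. 1 / (real h + 1)) m" for m
  define L where "L m = real m * ln (real m)" for m
  have h_meas[measurable]: "h m \<in> borel_measurable borel" for m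
    unfolding h_def[abs_def] toeplitz_sum_def by measurable
  have h_bounds: "0 \<le> h m x" "\<bar>h m x\<bar> \<le> real m * real m" "h m x \<le> 2 * real m / (1 - x)" if "x \<in> {0..<1}" for m x
    using toeplitz_sum_power_bounds[of x m] that by (auto simp: h_def)
  have const_int: "set_integrable lborel {0..<1::real} (\<lambda>x. c)" for c :: real
    unfolding set_integrable_def by (intro integrable_scaleR_left integrable_real_indicator) auto
  have g_int: "set_integrable lborel {0..<1} g"
    using set_integrable_mult_bounded[OF \<psi>, of "\<lambda>x. 1 / (1 + x)" 1] by (simp add: g_def[abs_def])
  have D_int: "set_integrable lborel {0..<1} D"
    unfolding D_def[abs_def] by (intro set_integral_diff g_int const_int)
  have h_int: "set_integrable lborel {0..<1} (h m)" for m
    using set_integrable_mult_bounded[OF const_int[of 1] h_meas h_bounds(2)] by simp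
  have Dh_int: "set_integrable lborel {0..<1} (\<lambda>x. D x * h m x)" for m
    using set_integrable_mult_bounded[OF D_int h_meas h_bounds(2)] .
  have gh_int: "set_integrable lborel {0..<1} (\<lambda>x. g x * h m x)" for m
    using set_integrable_mult_bounded[OF g_int h_meas h_bounds(2)] .
  have toep: "(LINT x:{0..<1}|lborel. f x * h m x) = toeplitz_sum (\<lambda>i. LINT x:{0..<1}|lborel. f x * x ^ i) m"
    if f: "set_integrable lborel {0..<1} f" for f m
  proof -
    have fi: "set_integrable lborel {0..<1} (\<lambda>x. f x * x ^ i)" for i
      by (rule set_integrable_mult_bounded[OF f, of _ 1]) (auto simp: power_abs power_le_one)
    have eq: "(\<lambda>x. indicator {0..<1} x *\<^sub>R (f x * h m x))
      = (\<lambda>x. \<Sum>k=1..m. \<Sum>l=1..m. indicator {0..<1} x *\<^sub>R (f x * x ^ (k - l + (l - k))))"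
      by (simp add: h_def toeplitz_sum_def sum_distrib_left fun_eq_iff mult.assoc)
    show ?thesis
      unfolding set_lebesgue_integral_def toeplitz_sum_def eq
      by (subst Bochner_Integration.integral_sum,
          intro Bochner_Integration.integrable_sum fi[unfolded set_integrable_def],
          intro sum.cong refl Bochner_Integration.integral_sum fi[unfolded set_integrable_def])
  qed
  have V: "toeplitz_sum (mixed_moment \<psi>) m = (LINT x:{0..<1}|lborel. g x * h m x)" for m
    unfolding toep[OF g_int] by (simp add: mixed_moment_def[abs_def] g_def)
  have A: "A m = (LINT x:{0..<1}|lborel. h m x)" for m
    using toep[OF const_int[of 1], of m] by (simp add: A_def integral_power_01)
  have E: "toeplitz_sum (mixed_moment \<psi>) m - \<psi>1 / 2 * A m = (LINT x:{0..<1}|lborel. D x * h m x)" for m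
  proof -
    have "(LINT x:{0..<1}|lborel. D x * h m x) = (LINT x:{0..<1}|lborel. g x * h m x - \<psi>1 / 2 * h m x)"
      by (simp add: D_def left_diff_distrib)
    also have "\<dots> = (LINT x:{0..<1}|lborel. g x * h m x) - (LINT x:{0..<1}|lborel. \<psi>1 / 2 * h m x)"
      by (intro set_integral_diff gh_int set_integrable_mult_right h_int)
    finally show ?thesis by (simp add: V A)
  qed
  define C where "C = (LINT x:{0..<1}|lborel. \<bar>D x\<bar>)"
  have absD: "set_integrable lborel {0..<1} (\<lambda>x. \<bar>D x\<bar>)" using set_integrable_abs[OF D_int] .
  have Dlim: "(D \<longlongrightarrow> 0) (at_left 1)"
  proof -
    have "((\<lambda>x. \<psi> x / (1 + x) - \<psi>1 / 2) \<longlongrightarrow> \<psi>1 / (1 + 1) - \<psi>1 / 2) (at_left 1)"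
      by (intro tendsto_intros lim) auto
    then show ?thesis by (simp add: D_def[abs_def] g_def)
  qed
  have est: "\<exists>\<delta>. 0 \<le> \<delta> \<and> \<delta> < 1 \<and> (\<forall>m. \<bar>toeplitz_sum (mixed_moment \<psi>) m - \<psi>1 / 2 * A m\<bar> \<le> e * A m + 2 * real m / (1 - \<delta>) * C)"
    if e: "0 < e" for e
  proof -
    have "\<forall>\<^sub>F x in at_left 1. \<bar>D x\<bar> < e" using tendstoD[OF Dlim e] by simp
    then obtain b where b: "b < 1" "\<And>x. b < x \<Longrightarrow> x < 1 \<Longrightarrow> \<bar>D x\<bar> < e"
      unfolding eventually_at_left_field by blast
    define \<delta> where "\<delta> = max 0 b"
    have \<delta>: "0 \<le> \<delta>" "\<delta> < 1" using b by (auto simp: \<delta>_def)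
    have "\<bar>toeplitz_sum (mixed_moment \<psi>) m - \<psi>1 / 2 * A m\<bar> \<le> e * A m + 2 * real m / (1 - \<delta>) * C" for m
    proof -
      have "\<bar>toeplitz_sum (mixed_moment \<psi>) m - \<psi>1 / 2 * A m\<bar> \<le> (LINT x:{0..<1}|lborel. \<bar>D x * h m x\<bar>)"
        unfolding E using set_integral_norm_bound[OF Dh_int[of m]] by simp
      also have "\<dots> \<le> (LINT x:{0..<1}|lborel. e * h m x + 2 * real m / (1 - \<delta>) * \<bar>D x\<bar>)"
      proof (rule set_integral_mono)
        show "set_integrable lborel {0..<1} (\<lambda>x. \<bar>D x * h m x\<bar>)" by (rule set_integrable_abs[OF Dh_int])
        show "set_integrable lborel {0..<1} (\<lambda>x. e * h m x + 2 * real m / (1 - \<delta>) * \<bar>D x\<bar>)"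
          by (intro set_integral_add set_integrable_mult_right h_int absD)
        fix x :: real assume x: "x \<in> {0..<1}"
        note hb = h_bounds[OF x, of m]
        have nn: "0 \<le> e * h m x" "0 \<le> 2 * real m / (1 - \<delta>) * \<bar>D x\<bar>" using e hb \<delta> by simp_all
        show "\<bar>D x * h m x\<bar> \<le> e * h m x + 2 * real m / (1 - \<delta>) * \<bar>D x\<bar>"
        proof (cases "\<delta> < x")
          case True
          then have "\<bar>D x\<bar> \<le> e" using b(2)[of x] x by (auto simp: \<delta>_def)
          then have "\<bar>D x\<bar> * h m x \<le> e * h m x" by (rule mult_right_mono) (use hb in auto)
          then show ?thesis using nn hb by (simp add: abs_mult)
        next
          case False
          have "h m x \<le> 2 * real m / (1 - x)" by (rule hb)
          also have "\<dots> \<le> 2 * real m / (1 - \<delta>)" using False \<delta> by (intro divide_left_mono) auto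
          finally have "\<bar>D x\<bar> * h m x \<le> \<bar>D x\<bar> * (2 * real m / (1 - \<delta>))" by (rule mult_left_mono) simp
          then show ?thesis using nn hb by (simp add: abs_mult mult.commute)
        qed
      qed
      also have "\<dots> = e * A m + 2 * real m / (1 - \<delta>) * C"
        unfolding A C_def by (subst set_integral_add) (auto intro!: set_integrable_mult_right h_int absD)
      finally show ?thesis .
    qed
    with \<delta> show ?thesis by blast
  qed
  have A_asymp: "(\<lambda>m. A m / L m) \<longlonglongrightarrow> 2"
    using toeplitz_sum_inverse_asymp by (simp add: A_def L_def)
  have l: "(\<lambda>m. 1 / ln (real m)) \<longlonglongrightarrow> 0"
    by (intro tendsto_divide_0[OF tendsto_const] filterlim_at_top_imp_at_infinity
        filterlim_compose[OF ln_at_top filterlim_real_sequentially])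
  have "(\<lambda>m. (toeplitz_sum (mixed_moment \<psi>) m - \<psi>1 / 2 * A m) / L m) \<longlonglongrightarrow> 0"
  proof (rule tendstoI)
    fix r :: real assume r: "0 < r"
    define e where "e = r / 3"
    have e: "0 < e" using r by (simp add: e_def)
    obtain \<delta> where \<delta>: "\<delta> < 1"
      "\<And>m. \<bar>toeplitz_sum (mixed_moment \<psi>) m - \<psi>1 / 2 * A m\<bar> \<le> e * A m + 2 * real m / (1 - \<delta>) * C"
      using est[OF e] by blast
    have "(\<lambda>m. e * (A m / L m) + 2 / (1 - \<delta>) * C * (1 / ln (real m))) \<longlonglongrightarrow> e * 2 + 2 / (1 - \<delta>) * C * 0"
      by (intro tendsto_intros A_asymp l)
    then have "\<forall>\<^sub>F m in sequentially. e * (A m / L m) + 2 / (1 - \<delta>) * C * (1 / ln (real m)) < r"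
      by (rule order_tendstoD) (use r in \<open>simp add: e_def\<close>)
    then show "\<forall>\<^sub>F m in sequentially. dist ((toeplitz_sum (mixed_moment \<psi>) m - \<psi>1 / 2 * A m) / L m) 0 < r"
      using eventually_gt_at_top[of 1]
    proof eventually_elim
      case (elim m)
      have L: "0 < L m" using elim by (simp add: L_def)
      have "\<bar>toeplitz_sum (mixed_moment \<psi>) m - \<psi>1 / 2 * A m\<bar> / L m \<le> (e * A m + 2 * real m / (1 - \<delta>) * C) / L m"
        using \<delta>(2)[of m] L by (intro divide_right_mono) auto
      also have "\<dots> = e * (A m / L m) + 2 / (1 - \<delta>) * C * (1 / ln (real m))"
        using elim \<delta>(1) by (simp add: add_divide_distrib L_def)
      finally show ?case using elim L by (simp add: dist_real_def)
    qed
  qed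
  from tendsto_add[OF this tendsto_mult[OF tendsto_const A_asymp, of "\<psi>1 / 2"]]
  have "(\<lambda>m. toeplitz_sum (mixed_moment \<psi>) m / L m) \<longlonglongrightarrow> \<psi>1"
    by (simp add: diff_divide_distrib)
  then show ?thesis by (simp add: L_def)
qed

lemma toeplitz_mixed_moment_scaling:
  fixes \<psi> :: "real \<Rightarrow> real"
  assumes \<psi>: "set_integrable lborel {0..<1} \<psi>" and lim: "(\<psi> \<longlongrightarrow> \<psi>1) (at_left 1)"
    and p: "(\<lambda>n. real (p n) / real n) \<longlonglongrightarrow> t" and t: "0 < t"
  shows "(\<lambda>n. toeplitz_sum (mixed_moment \<psi>) (p n) / (real n * ln (real n))) \<longlonglongrightarrow> \<psi>1 * t"
proof -
  have "filterlim (\<lambda>n. real (p n) / real n * real n) at_top sequentially"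
    by (rule filterlim_tendsto_pos_mult_at_top[OF p t filterlim_real_sequentially])
  then have "filterlim (\<lambda>n. real (p n)) at_top sequentially"
    by (rule filterlim_cong[OF refl refl, THEN iffD1, rotated])
       (use eventually_gt_at_top[of 0] in eventually_elim, simp)
  then have p_top: "filterlim p at_top sequentially"
    by (simp add: filterlim_real_sequentially filterlim_sequentially_iff_filterlim_real)
  have l: "(\<lambda>m. 1 / ln (real m)) \<longlonglongrightarrow> 0"
    by (intro tendsto_divide_0[OF tendsto_const] filterlim_at_top_imp_at_infinity
        filterlim_compose[OF ln_at_top filterlim_real_sequentially])
  have main: "(\<lambda>n. toeplitz_sum (mixed_moment \<psi>) (p n) / (real (p n) * ln (real (p n)))) \<longlonglongrightarrow> \<psi>1"
    by (rule filterlim_compose[OF toeplitz_mixed_moment_asymp[OF \<psi> lim] p_top])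
  \<comment> \<open>\<open>ln (p n) / ln n \<rightarrow> 1\<close>, since \<open>ln (p n) = ln n + ln (p n / n)\<close>.\<close>
  have ln_ratio: "(\<lambda>n. ln (real (p n) / real n) * (1 / ln (real n)) + 1) \<longlonglongrightarrow> ln t * 0 + 1"
    using t by (intro tendsto_intros p l) auto
  have "(\<lambda>n. toeplitz_sum (mixed_moment \<psi>) (p n) / (real (p n) * ln (real (p n)))
      * ((real (p n) / real n) * (ln (real (p n) / real n) * (1 / ln (real n)) + 1))) \<longlonglongrightarrow> \<psi>1 * (t * (ln t * 0 + 1))"
    by (intro tendsto_mult main p ln_ratio)
  moreover have "\<forall>\<^sub>F n in sequentially. toeplitz_sum (mixed_moment \<psi>) (p n) / (real (p n) * ln (real (p n)))
      * ((real (p n) / real n) * (ln (real (p n) / real n) * (1 / ln (real n)) + 1))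
      = toeplitz_sum (mixed_moment \<psi>) (p n) / (real n * ln (real n))"
    using eventually_gt_at_top[of 1] filterlim_at_top[THEN iffD1, OF p_top, THEN spec, of 2]
  proof eventually_elim
    case (elim n)
    then have "0 < ln (real (p n))" "0 < ln (real n)" by simp_all
    moreover have "ln (real (p n) / real n) = ln (real (p n)) - ln (real n)"
      using elim by (simp add: ln_div)
    ultimately show ?case using elim by (simp add: field_simps)
  qed
  ultimately show ?thesis by (auto dest: Lim_transform_eventually)
qed

lemma nat_floor_over: "0 \<le> t \<Longrightarrow> (\<lambda>n. real (nat \<lfloor>real n * t\<rfloor>) / real n) \<longlonglongrightarrow> t"
proof (rule tendsto_sandwich)
  assume t: "0 \<le> t"
  have fl: "real n * t - 1 \<le> real (nat \<lfloor>real n * t\<rfloor>)" "real (nat \<lfloor>real n * t\<rfloor>) \<le> real n * t" for n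
    using t by (auto simp: of_nat_nat)
  show "\<forall>\<^sub>F n in sequentially. t - 1 / real n \<le> real (nat \<lfloor>real n * t\<rfloor>) / real n"
    using eventually_gt_at_top[of 0]
  proof eventually_elim
    case (elim n)
    then have "t - 1 / real n = (real n * t - 1) / real n" by (simp add: field_simps)
    also have "\<dots> \<le> real (nat \<lfloor>real n * t\<rfloor>) / real n" using fl by (intro divide_right_mono) auto
    finally show ?case .
  qed
  show "\<forall>\<^sub>F n in sequentially. real (nat \<lfloor>real n * t\<rfloor>) / real n \<le> t"
    using eventually_gt_at_top[of 0]
  proof eventually_elim
    case (elim n)
    have "real (nat \<lfloor>real n * t\<rfloor>) / real n \<le> (real n * t) / real n" using fl by (intro divide_right_mono) auto
    with elim show ?case by simp
  qed
  show "(\<lambda>n. t - 1 / real n) \<longlonglongrightarrow> t"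
    using tendsto_diff[OF tendsto_const lim_1_over_n, of t] by simp
qed simp

lemma rectangle_mixed_moment_asymp:
  fixes \<psi> :: "real \<Rightarrow> real"
  assumes \<psi>: "set_integrable lborel {0..<1} \<psi>" and lim: "(\<psi> \<longlongrightarrow> \<psi>1) (at_left 1)" and st: "0 \<le> s" "0 \<le> t"
  shows "(\<lambda>n. (\<Sum>k=1..nat \<lfloor>real n * s\<rfloor>. \<Sum>l=1..nat \<lfloor>real n * t\<rfloor>. mixed_moment \<psi> (k - l + (l - k)))
      / (real n * ln (real n))) \<longlonglongrightarrow> \<psi>1 * min s t"
  using st
proof (induction s t rule: linorder_wlog)
  case (le s t)
  let ?p = "\<lambda>t n. nat \<lfloor>real n * t\<rfloor>" and ?V = "toeplitz_sum (mixed_moment \<psi>)"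
  have zero: "?V 0 = 0" by (simp add: toeplitz_sum_def)
  have V: "(\<lambda>n. ?V (?p t n) / (real n * ln (real n))) \<longlonglongrightarrow> \<psi>1 * t" if "0 \<le> t" for t
  proof (cases "t = 0")
    case False
    with that show ?thesis by (intro toeplitz_mixed_moment_scaling[OF \<psi> lim] nat_floor_over) auto
  qed (simp add: zero)
  have mono: "?p s n \<le> ?p t n" for n
    using le by (intro nat_mono floor_mono mult_left_mono) auto
  have Vd: "(\<lambda>n. ?V (?p t n - ?p s n) / (real n * ln (real n))) \<longlonglongrightarrow> \<psi>1 * (t - s)"
  proof (cases "s = t")
    case False
    have "(\<lambda>n. real (?p t n) / real n - real (?p s n) / real n) \<longlonglongrightarrow> t - s"
      using le by (intro tendsto_diff nat_floor_over) auto
    then have "(\<lambda>n. real (?p t n - ?p s n) / real n) \<longlonglongrightarrow> t - s"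
      using mono by (simp add: of_nat_diff diff_divide_distrib)
    with False le show ?thesis by (intro toeplitz_mixed_moment_scaling[OF \<psi> lim]) auto
  qed (simp add: zero)
  have limit: "(\<lambda>n. (?V (?p s n) / (real n * ln (real n)) + ?V (?p t n) / (real n * ln (real n))
      - ?V (?p t n - ?p s n) / (real n * ln (real n))) / 2) \<longlonglongrightarrow> (\<psi>1 * s + \<psi>1 * t - \<psi>1 * (t - s)) / 2"
    using le by (intro tendsto_intros V Vd) auto
  have half: "(\<psi>1 * s + \<psi>1 * t - \<psi>1 * (t - s)) / 2 = \<psi>1 * min s t"
    using le by (simp add: algebra_simps)
  have eq: "(x + y - z) / 2 / c = (x / c + y / c - z / c) / 2" for x y z c :: real
    by (simp add: add_divide_distrib diff_divide_distrib mult.commute)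
  from limit show ?case unfolding toeplitz_rectangle[OF mono] eq half .
next
  case (sym s t)
  have "(\<Sum>k=1..p. \<Sum>l=1..q. mixed_moment \<psi> (k - l + (l - k))) = (\<Sum>k=1..q. \<Sum>l=1..p. mixed_moment \<psi> (k - l + (l - k)))" for p q
    by (subst sum.swap) (simp add: add.commute)
  with sym show ?case by (simp only: min.commute)
qed

section \<open>Finite-dimensional distributions of the Wiener process\<close>

text \<open>
  Sorting \<open>I\<close> as \<open>u 1 < \<dots> < u d\<close>, with \<open>u 0 = 0\<close>, writes the linear combination in terms of
  independent increments. The covariance comes back through
  \<open>min (u j) (u k) = \<Sum>i < min j k. u (i + 1) - u i\<close>.
\<close>

lemma wiener_iexp:
  assumes W: "standard_wiener L B" and I: "finite I" "I \<subseteq> {0..}"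
  shows "(CLINT \<omega>|L. iexp (\<Sum>t\<in>I. \<theta> t * B t \<omega>)) = of_real (exp (- (\<Sum>s\<in>I. \<Sum>t\<in>I. \<theta> s * \<theta> t * min s t) / 2))"
proof (cases "I = {}")
  case True
  interpret prob_space L using W by (simp add: standard_wiener_def real_process_def)
  show ?thesis using True by (simp add: prob_space)
next
  case False
  interpret prob_space L using W by (simp add: standard_wiener_def real_process_def)
  have B[measurable]: "B t \<in> borel_measurable L" if "0 \<le> t" for t
    using W that by (simp add: standard_wiener_def real_process_def)
  define ts where "ts = sorted_list_of_set I"
  define d where "d = length ts"
  \<comment> \<open>Beyond index \<open>d\<close> the sequence stays at the largest time, so that it is monotone on all of \<open>nat\<close>.\<close>
  define u where "u i = (if i = 0 then 0 else ts ! (min i d - 1))" for i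
  have ts: "set ts = I" "distinct ts" "sorted ts" using I by (simp_all add: ts_def)
  have d: "0 < d" using ts(1) False by (auto simp: d_def)
  have u_Suc: "u (Suc j) = ts ! j" if "j < d" for j
    using that by (simp add: u_def min_def)
  have ts0: "0 \<le> ts ! j" if "j < d" for j
    using ts(1) that I by (auto simp: d_def)
  have mono: "mono u"
  proof (rule monoI)
    fix i j :: nat assume "i \<le> j"
    then have "min i d - 1 \<le> min j d - 1" "min j d - 1 < d" using d by auto
    then have "ts ! (min i d - 1) \<le> ts ! (min j d - 1)" "0 \<le> ts ! (min j d - 1)"
      using ts0 sorted_nth_mono[OF ts(3)] by (auto simp: d_def)
    with \<open>i \<le> j\<close> show "u i \<le> u j" by (simp add: u_def)
  qed
  have u0: "u 0 = 0" by (simp add: u_def)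
  have u_nonneg: "0 \<le> u i" for i using monoD[OF mono, of 0 i] u0 by simp
  define \<Delta> where "\<Delta> i \<omega> = B (u (Suc i)) \<omega> - B (u i) \<omega>" for i \<omega>
  have ind: "indep_vars (\<lambda>_. borel) \<Delta> {..<d}"
  proof -
    have "\<forall>(n::nat) u. 0 \<le> u 0 \<and> mono u \<longrightarrow>
        indep_vars (\<lambda>_. borel) (\<lambda>i \<omega>. B (u (Suc i)) \<omega> - B (u i) \<omega>) {..<n}"
      using W unfolding standard_wiener_def by (elim conjE)
    from this[THEN spec, of d, THEN spec, of u] show ?thesis
      using mono u0 unfolding \<Delta>_def[abs_def] by simp
  qed
  have law: "distr L borel (\<Delta> i) = normal_law 0 (u (Suc i) - u i)" for i
  proof -
    have "\<forall>s t. 0 \<le> s \<and> s \<le> t \<longrightarrow> distr L borel (\<lambda>\<omega>. B t \<omega> - B s \<omega>) = normal_law 0 (t - s)"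
      using W unfolding standard_wiener_def by (elim conjE)
    from this[THEN spec, of "u i", THEN spec, of "u (Suc i)"] show ?thesis
      using u_nonneg[of i] monoD[OF mono, of i "Suc i"] unfolding \<Delta>_def[abs_def] by simp
  qed
  have sum_I: "(\<Sum>t\<in>I. f t) = (\<Sum>j<d. f (ts ! j))" for f :: "real \<Rightarrow> real"
    using sum.reindex_bij_betw[OF bij_betw_nth[OF ts(2) refl], of I f] ts(1) by (simp add: d_def)
  have cut: "(\<Sum>i<d. (if i \<le> j then x i else 0)) = (\<Sum>i<Suc j. x i)" if "j < d" for j and x :: "nat \<Rightarrow> real"
    using that by (intro sum.mono_neutral_cong_right) auto
  define b where "b i = (\<Sum>j<d. if i \<le> j then \<theta> (ts ! j) else 0)" for i
  have B0: "AE \<omega> in L. B 0 \<omega> = 0" using W by (simp add: standard_wiener_def)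
  have lin: "(\<Sum>t\<in>I. \<theta> t * B t \<omega>) = (\<Sum>i<d. b i * \<Delta> i \<omega>)" if "B 0 \<omega> = 0" for \<omega>
  proof -
    have "B (ts ! j) \<omega> = (\<Sum>i<d. if i \<le> j then \<Delta> i \<omega> else 0)" if "j < d" for j
      using sum_lessThan_telescope[of "\<lambda>i. B (u i) \<omega>" "Suc j"] \<open>B 0 \<omega> = 0\<close> u0 that
      by (simp add: cut \<Delta>_def u_Suc del: sum.lessThan_Suc)
    then have "(\<Sum>t\<in>I. \<theta> t * B t \<omega>) = (\<Sum>j<d. \<Sum>i<d. \<theta> (ts ! j) * (if i \<le> j then \<Delta> i \<omega> else 0))"
      by (simp add: sum_I sum_distrib_left)
    also have "\<dots> = (\<Sum>i<d. \<Sum>j<d. \<theta> (ts ! j) * (if i \<le> j then \<Delta> i \<omega> else 0))" by (rule sum.swap)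
    also have "\<dots> = (\<Sum>i<d. b i * \<Delta> i \<omega>)"
      unfolding b_def sum_distrib_right by (intro sum.cong refl) simp
    finally show ?thesis .
  qed
  have var: "(\<Sum>i<d. (b i)\<^sup>2 * (u (Suc i) - u i)) = (\<Sum>s\<in>I. \<Sum>t\<in>I. \<theta> s * \<theta> t * min s t)"
  proof -
    have min_eq: "(\<Sum>i<d. (if i \<le> j then 1 else 0) * (if i \<le> k then 1 else 0) * (u (Suc i) - u i)) = min (ts ! j) (ts ! k)"
      if "j < d" "k < d" for j k
    proof -
      have "(\<Sum>i<d. (if i \<le> j then 1 else 0) * (if i \<le> k then 1 else 0) * (u (Suc i) - u i))
        = (\<Sum>i<d. if i \<le> min j k then u (Suc i) - u i else 0)"
        by (intro sum.cong) auto
      also have "\<dots> = u (Suc (min j k)) - u 0"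
        using that by (subst cut) (auto simp only: sum_lessThan_telescope)
      also have "\<dots> = min (ts ! j) (ts ! k)"
        using that u_Suc[of "min j k"] u0 sorted_nth_mono[OF ts(3), of j k] sorted_nth_mono[OF ts(3), of k j]
        by (cases "j \<le> k") (auto simp: min_def d_def)
      finally show ?thesis .
    qed
    have "(\<Sum>i<d. (b i)\<^sup>2 * (u (Suc i) - u i))
      = (\<Sum>i<d. \<Sum>j<d. \<Sum>k<d. \<theta> (ts ! j) * \<theta> (ts ! k) * ((if i \<le> j then 1 else 0) * (if i \<le> k then 1 else 0) * (u (Suc i) - u i)))"
      unfolding b_def power2_eq_square sum_product unfolding sum_distrib_right by (intro sum.cong refl) simp
    also have "\<dots> = (\<Sum>j<d. \<Sum>k<d. \<Sum>i<d. \<theta> (ts ! j) * \<theta> (ts ! k) * ((if i \<le> j then 1 else 0) * (if i \<le> k then 1 else 0) * (u (Suc i) - u i)))"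
      by (rule trans[OF sum.swap]) (intro sum.cong refl sum.swap)
    also have "\<dots> = (\<Sum>j<d. \<Sum>k<d. \<theta> (ts ! j) * \<theta> (ts ! k) * min (ts ! j) (ts ! k))"
      by (intro sum.cong refl, subst sum_distrib_left[symmetric], subst min_eq) auto
    finally show ?thesis by (simp add: sum_I)
  qed
  have m1: "(\<lambda>\<omega>. \<Sum>t\<in>I. \<theta> t * B t \<omega>) \<in> borel_measurable L"
    using I by (intro borel_measurable_sum borel_measurable_times borel_measurable_const B) auto
  have m2: "(\<lambda>\<omega>. \<Sum>i<d. b i * \<Delta> i \<omega>) \<in> borel_measurable L"
    unfolding \<Delta>_def
    by (intro borel_measurable_sum borel_measurable_times borel_measurable_diff borel_measurable_const B u_nonneg)
  have "(CLINT \<omega>|L. iexp (\<Sum>t\<in>I. \<theta> t * B t \<omega>)) = (CLINT \<omega>|L. iexp (\<Sum>i<d. b i * \<Delta> i \<omega>))"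
  proof (rule integral_cong_AE)
    show "(\<lambda>\<omega>. iexp (\<Sum>t\<in>I. \<theta> t * B t \<omega>)) \<in> borel_measurable L"
      by (rule measurable_compose[OF m1]) measurable
    show "(\<lambda>\<omega>. iexp (\<Sum>i<d. b i * \<Delta> i \<omega>)) \<in> borel_measurable L"
      by (rule measurable_compose[OF m2]) measurable
    show "AE \<omega> in L. iexp (\<Sum>t\<in>I. \<theta> t * B t \<omega>) = iexp (\<Sum>i<d. b i * \<Delta> i \<omega>)"
      using B0 by eventually_elim (simp only: lin)
  qed
  also have "\<dots> = of_real (exp (- (\<Sum>i<d. (b i)\<^sup>2 * (u (Suc i) - u i)) / 2))"
    by (intro indep_normal_sum_iexp ind law) (simp add: monoD[OF mono, of _ "Suc _"])
  finally show ?thesis unfolding var .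
qed

section \<open>The iterated limit\<close>

text \<open>
  The coefficient of the \<open>k\<close>-th term in a linear combination, with coefficients \<open>\<theta> t\<close>, of the sums of
  the first \<open>p t\<close> terms.
\<close>

definition sum_weight :: "(real \<Rightarrow> nat) \<Rightarrow> real set \<Rightarrow> (real \<Rightarrow> real) \<Rightarrow> nat \<Rightarrow> real" where
  "sum_weight p I \<theta> k = (\<Sum>t\<in>I. if 1 \<le> k \<and> k \<le> p t then \<theta> t else 0)"

lemma sum_weight_linear:
  assumes "\<And>t. t \<in> I \<Longrightarrow> p t < m"
  shows "(\<Sum>t\<in>I. \<theta> t * (\<Sum>k=1..p t. x k)) = (\<Sum>k<m. sum_weight p I \<theta> k * x k)"
proof -
  have "(\<Sum>t\<in>I. \<theta> t * (\<Sum>k=1..p t. x k)) = (\<Sum>t\<in>I. \<Sum>k<m. (if 1 \<le> k \<and> k \<le> p t then \<theta> t else 0) * x k)"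
  proof (rule sum.cong[OF refl])
    fix t assume "t \<in> I"
    then show "\<theta> t * (\<Sum>k=1..p t. x k) = (\<Sum>k<m. (if 1 \<le> k \<and> k \<le> p t then \<theta> t else 0) * x k)"
      unfolding sum_distrib_left using assms[of t] by (intro sum.mono_neutral_cong_left) auto
  qed
  also have "\<dots> = (\<Sum>k<m. \<Sum>t\<in>I. (if 1 \<le> k \<and> k \<le> p t then \<theta> t else 0) * x k)" by (rule sum.swap)
  finally show ?thesis by (simp add: sum_weight_def sum_distrib_right)
qed

lemma sum_weight_quadratic:
  assumes "\<And>t. t \<in> I \<Longrightarrow> p t < m"
  shows "(\<Sum>k<m. \<Sum>l<m. sum_weight p I \<theta> k * sum_weight p I \<theta> l * K k l)
    = (\<Sum>s\<in>I. \<Sum>t\<in>I. \<theta> s * \<theta> t * (\<Sum>k=1..p s. \<Sum>l=1..p t. K k l))"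
proof -
  have "(\<Sum>k<m. \<Sum>l<m. sum_weight p I \<theta> k * sum_weight p I \<theta> l * K k l)
    = (\<Sum>k<m. sum_weight p I \<theta> k * (\<Sum>l<m. sum_weight p I \<theta> l * K k l))"
    by (simp add: sum_distrib_left mult.assoc)
  also have "\<dots> = (\<Sum>s\<in>I. \<theta> s * (\<Sum>k=1..p s. \<Sum>t\<in>I. \<theta> t * (\<Sum>l=1..p t. K k l)))"
    using assms by (simp only: sum_weight_linear[where m = m])
  also have "\<dots> = (\<Sum>s\<in>I. \<theta> s * (\<Sum>t\<in>I. \<Sum>k=1..p s. \<theta> t * (\<Sum>l=1..p t. K k l)))"
    by (subst sum.swap) (rule refl)
  finally show ?thesis by (simp add: sum_distrib_left mult.assoc)
qed

theorem theorem3p3: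
  fixes \<sigma>2 \<beta> \<psi>1 :: real and \<psi> :: "real \<Rightarrow> real"
    and M0 :: "'b measure" and \<alpha> :: "'b \<Rightarrow> real" and X :: "nat \<Rightarrow> 'b \<Rightarrow> real"
    and M :: "'a measure" and \<alpha>j :: "nat \<Rightarrow> 'a \<Rightarrow> real" and Xj :: "nat \<Rightarrow> nat \<Rightarrow> 'a \<Rightarrow> real"
    and L :: "'c measure" and B :: "real \<Rightarrow> 'c \<Rightarrow> real"
  assumes "0 \<le> \<sigma>2"
    and "\<forall>\<omega>\<in>space M0. \<alpha> \<omega> \<in> {0..<1}"
    and "distributed M0 lborel \<alpha> (\<lambda>x. ennreal (indicator {0..<1} x * (\<psi> x * (1 - x) powr \<beta>)))"
    and "AE x in lborel. x \<in> {0..<1} \<longrightarrow> 0 \<le> \<psi> x"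
    and "set_integrable lborel {0..<1} \<psi>"
    and "(\<psi> \<longlongrightarrow> \<psi>1) (at_left 1)" and "0 < \<psi>1"
    and "randomized_ar1 M0 \<sigma>2 \<alpha> X"
    and "independent_copies M \<alpha>j Xj M0 \<alpha> X"
    and "standard_wiener L B"
    and "\<beta> = 1"
  shows "iterated_fdd_lim 2 M
           (\<lambda>N n t \<omega>. (real n * ln (real n)) powr (- 1 / 2) * real N powr (- 1 / 2)
                        * aggregated_sum Xj N n t \<omega>)
           L (\<lambda>t \<omega>. sqrt (\<sigma>2 * \<psi>1) * B t \<omega>)"
proof -
  note v = assms(1) and \<psi> = assms(5) and lim = assms(6) and \<psi>1 = assms(7) and copies = assms(9) and W = assms(10)
  have M0: "prob_space M0" using assms(8) by (simp add: randomized_ar1_def)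
  have \<alpha>: "\<alpha> \<in> borel_measurable M0" using assms(3) by (simp add: distributed_def)
  note X = randomized_ar1_moments[OF v assms(2) assms(3)[unfolded assms(11)] assms(4) \<psi> assms(8)]
  \<comment> \<open>The terms of the inner limit process: Gaussian, with the covariance of a single copy.\<close>
  obtain G where G_meas: "\<And>k. G k \<in> borel_measurable normal_noise"
    and G_iexp: "\<And>m w. (CLINT \<omega>|normal_noise. iexp (\<Sum>k<m. w k * G k \<omega>))
        = of_real (exp (- (\<Sum>k<m. \<Sum>l<m. w k * w l * (LINT \<omega>|M0. X k \<omega> * X l \<omega>)) / 2))"
    by (rule gaussian_sequence_exists[of X M0]) (use X in auto)
  define a where "a n = (real n * ln (real n)) powr (- 1 / 2)" for n
  define p where "p n t = nat \<lfloor>real n * t\<rfloor>" for n t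
  define Y where "Y n t \<omega> = a n * (\<Sum>k=1..p n t. G k \<omega>)" for n t \<omega>
  \<comment> \<open>A common bound for the numbers of summands at the finitely many times in \<open>I\<close>.\<close>
  define bnd where "bnd n I = Suc (\<Sum>t\<in>I. p n t)" for n I
  have bnd: "p n t < bnd n I" if "finite I" "t \<in> I" for n t I
    unfolding bnd_def using that by (auto simp: less_Suc_eq_le intro: member_le_sum)
  have Y_process: "real_process normal_noise (Y n)" for n
    unfolding real_process_def Y_def using G_meas prob_space_normal_noise
    by (auto intro!: borel_measurable_times borel_measurable_sum)
  have Xj: "Xj j k \<in> borel_measurable M" if "1 \<le> j" for j k
  proof -
    have "(\<lambda>\<omega>. (\<alpha>j j \<omega>, \<lambda>k. Xj j k \<omega>)) \<in> M \<rightarrow>\<^sub>M borel \<Otimes>\<^sub>M seq0_space"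
      using copies that unfolding independent_copies_def by (auto simp: prob_space.indep_vars_def)
    from measurable_compose[OF this, of "\<lambda>y. snd y k" borel] show ?thesis by simp
  qed
  have Z_process: "real_process M (\<lambda>t \<omega>. a n * real N powr (- 1 / 2) * aggregated_sum Xj N n t \<omega>)" for n N
    unfolding real_process_def aggregated_sum_def using copies Xj
    by (auto simp: independent_copies_def intro!: borel_measurable_times borel_measurable_sum)
  have W_process: "real_process L (\<lambda>t \<omega>. sqrt (\<sigma>2 * \<psi>1) * B t \<omega>)"
    using W by (auto simp: standard_wiener_def real_process_def)
  have Y_iexp: "(CLINT \<omega>|normal_noise. iexp (\<Sum>t\<in>I. \<theta> t * Y n t \<omega>))
      = of_real (exp (- ((a n)\<^sup>2 * (\<Sum>k<bnd n I. \<Sum>l<bnd n I. sum_weight (p n) I \<theta> k * sum_weight (p n) I \<theta> l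
          * (LINT \<omega>|M0. X k \<omega> * X l \<omega>))) / 2))" if I: "finite I" for I \<theta> n
  proof -
    have "(\<Sum>t\<in>I. \<theta> t * Y n t \<omega>) = (\<Sum>k<bnd n I. a n * sum_weight (p n) I \<theta> k * G k \<omega>)" for \<omega>
    proof -
      have "(\<Sum>t\<in>I. \<theta> t * Y n t \<omega>) = a n * (\<Sum>t\<in>I. \<theta> t * (\<Sum>k=1..p n t. G k \<omega>))"
        by (simp add: Y_def sum_distrib_left mult.left_commute)
      also have "\<dots> = a n * (\<Sum>k<bnd n I. sum_weight (p n) I \<theta> k * G k \<omega>)"
        by (simp only: sum_weight_linear[of I "p n" "bnd n I", OF bnd[OF I]])
      finally show ?thesis by (simp add: sum_distrib_left mult.assoc)
    qed
    then show ?thesis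
      by (simp only: G_iexp) (simp add: sum_distrib_left power2_eq_square ac_simps)
  qed
  \<comment> \<open>For each \<open>n\<close> and each linear combination both sides have the same quadratic form in the exponent.\<close>
  have inner: "fdd_lim (\<lambda>_. M) (\<lambda>N t \<omega>. a n * real N powr (- 1 / 2) * aggregated_sum Xj N n t \<omega>) normal_noise (Y n)" for n
  proof (rule fdd_lim_by_iexp[OF Z_process Y_process])
    fix I :: "real set" and \<theta> :: "real \<Rightarrow> real" assume I: "finite I" "I \<subseteq> {0..}"
    have eq: "(\<Sum>t\<in>I. \<theta> t * (a n * real N powr (- 1 / 2) * aggregated_sum Xj N n t \<omega>))
      = real N powr (- 1 / 2) * (\<Sum>j=1..N. \<Sum>k<bnd n I. a n * sum_weight (p n) I \<theta> k * Xj j k \<omega>)" for N \<omega>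
    proof -
      have "(\<Sum>t\<in>I. \<theta> t * (a n * real N powr (- 1 / 2) * aggregated_sum Xj N n t \<omega>))
        = (\<Sum>t\<in>I. \<Sum>j=1..N. a n * real N powr (- 1 / 2) * (\<theta> t * (\<Sum>k=1..p n t. Xj j k \<omega>)))"
        by (simp add: aggregated_sum_def p_def sum_distrib_left ac_simps)
      also have "\<dots> = (\<Sum>j=1..N. \<Sum>t\<in>I. a n * real N powr (- 1 / 2) * (\<theta> t * (\<Sum>k=1..p n t. Xj j k \<omega>)))"
        by (rule sum.swap)
      also have "\<dots> = (\<Sum>j=1..N. a n * real N powr (- 1 / 2) * (\<Sum>k<bnd n I. sum_weight (p n) I \<theta> k * Xj j k \<omega>))"
        by (simp only: sum_distrib_left[symmetric] sum_weight_linear[of I "p n" "bnd n I", OF bnd[OF I(1)]])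
      finally show ?thesis by (simp add: sum_distrib_left ac_simps)
    qed
    have rhs: "(CLINT \<omega>|normal_noise. iexp (\<Sum>t\<in>I. \<theta> t * Y n t \<omega>))
      = of_real (exp (- (\<Sum>k<bnd n I. \<Sum>l<bnd n I. (a n * sum_weight (p n) I \<theta> k) * (a n * sum_weight (p n) I \<theta> l)
          * (LINT \<omega>|M0. X k \<omega> * X l \<omega>)) / 2))"
      unfolding Y_iexp[OF I(1)] by (simp add: sum_distrib_left power2_eq_square ac_simps)
    show "(\<lambda>N. CLINT \<omega>|M. iexp (\<Sum>t\<in>I. \<theta> t * (a n * real N powr (- 1 / 2) * aggregated_sum Xj N n t \<omega>)))
      \<longlonglongrightarrow> (CLINT \<omega>|normal_noise. iexp (\<Sum>t\<in>I. \<theta> t * Y n t \<omega>))"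
      unfolding eq rhs by (rule independent_copies_iexp[OF copies M0 \<alpha> X(1) X(2) X(3)])
  qed
  \<comment> \<open>For \<open>n \<ge> 2\<close> the squared normalisation is \<open>1 / (n log n)\<close>, and the quadratic forms converge.\<close>
  have outer: "fdd_lim (\<lambda>_. normal_noise) Y L (\<lambda>t \<omega>. sqrt (\<sigma>2 * \<psi>1) * B t \<omega>)"
  proof (rule fdd_lim_by_iexp[OF Y_process W_process])
    fix I :: "real set" and \<theta> :: "real \<Rightarrow> real" assume I: "finite I" "I \<subseteq> {0..}"
    define R where "R n s t = (\<Sum>k=1..p n s. \<Sum>l=1..p n t. mixed_moment \<psi> (k - l + (l - k)))" for n s t
    have lhs: "(CLINT \<omega>|normal_noise. iexp (\<Sum>t\<in>I. \<theta> t * Y n t \<omega>))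
      = of_real (exp (- (\<Sum>s\<in>I. \<Sum>t\<in>I. \<theta> s * \<theta> t * (\<sigma>2 * (R n s t / (real n * ln (real n))))) / 2))"
      if n: "2 \<le> n" for n
    proof -
      have "0 < real n * ln (real n)" using n by simp
      then have a2: "(a n)\<^sup>2 = 1 / (real n * ln (real n))"
        by (simp add: a_def powr_minus powr_half_sqrt power_inverse inverse_eq_divide power_divide)
      have "(\<Sum>k<bnd n I. \<Sum>l<bnd n I. sum_weight (p n) I \<theta> k * sum_weight (p n) I \<theta> l * (LINT \<omega>|M0. X k \<omega> * X l \<omega>))
        = (\<Sum>s\<in>I. \<Sum>t\<in>I. \<theta> s * \<theta> t * (\<sigma>2 * R n s t))"
        by (simp only: sum_weight_quadratic[of I "p n" "bnd n I", OF bnd[OF I(1)]] X(4) sum_distrib_left[symmetric] R_def)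
      then show ?thesis
        unfolding Y_iexp[OF I(1)] a2 by (simp add: sum_divide_distrib)
    qed
    have rhs: "(CLINT \<omega>|L. iexp (\<Sum>t\<in>I. \<theta> t * (sqrt (\<sigma>2 * \<psi>1) * B t \<omega>)))
      = of_real (exp (- (\<Sum>s\<in>I. \<Sum>t\<in>I. \<theta> s * \<theta> t * (\<sigma>2 * (\<psi>1 * min s t))) / 2))"
    proof -
      have sq: "sqrt (\<sigma>2 * \<psi>1) * (sqrt (\<sigma>2 * \<psi>1) * x) = \<sigma>2 * (\<psi>1 * x)" for x
        using v \<psi>1 by (simp add: mult.assoc[symmetric])
      have "(\<theta> s * sqrt (\<sigma>2 * \<psi>1)) * (\<theta> t * sqrt (\<sigma>2 * \<psi>1)) * min s t = \<theta> s * \<theta> t * (\<sigma>2 * (\<psi>1 * min s t))" for s t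
        unfolding sq[symmetric] by (simp only: ac_simps)
      then show ?thesis
        using wiener_iexp[OF W I, of "\<lambda>t. \<theta> t * sqrt (\<sigma>2 * \<psi>1)"] by (simp only: mult.assoc[symmetric])
    qed
    have "(\<lambda>n. complex_of_real (exp (- (\<Sum>s\<in>I. \<Sum>t\<in>I. \<theta> s * \<theta> t * (\<sigma>2 * (R n s t / (real n * ln (real n))))) / 2)))
      \<longlonglongrightarrow> of_real (exp (- (\<Sum>s\<in>I. \<Sum>t\<in>I. \<theta> s * \<theta> t * (\<sigma>2 * (\<psi>1 * min s t))) / 2))"
      unfolding R_def p_def using I by (intro tendsto_intros rectangle_mixed_moment_asymp[OF \<psi> lim]) auto
    then show "(\<lambda>n. CLINT \<omega>|normal_noise. iexp (\<Sum>t\<in>I. \<theta> t * Y n t \<omega>))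
      \<longlonglongrightarrow> (CLINT \<omega>|L. iexp (\<Sum>t\<in>I. \<theta> t * (sqrt (\<sigma>2 * \<psi>1) * B t \<omega>)))"
      unfolding rhs
      by (rule Lim_transform_eventually)
         (use eventually_ge_at_top[of 2] in eventually_elim, simp only: lhs)
  qed
  show ?thesis
    unfolding iterated_fdd_lim_def a_def[symmetric]
    using Y_process inner outer by (intro exI[of _ "\<lambda>_. normal_noise"] exI[of _ Y]) blast
qed

end
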